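(* Let $\alpha,a_1,\dots,a_n,b,c,x_1,\dots,x_n$ be complex parameters such that either $|\alpha a_{1}\cdots a_{n}bc/q^{1+n}|<1$, or $a_r=q^{N_r}$ with $N_r$ a positive integer for $r=1,\dots,n$ (so that the series terminates). Suppose that none of the denominators in the following identity vanishes. Then $$\begin{aligned} & \frac{(\alpha bc/q,\ \alpha a_{1}\cdots a_{n}cq^{-n})_{\infty}}{(\alpha c,\ \alpha a_{1}\cdots a_{n}bcq^{-(1+n)})_{\infty}}\prod_{r=1}^{n}\frac{(\alpha qx_{r},\alpha a_{r}bx_{r}/q)_{\infty}}{(\alpha bx_{r},\alpha a_{r}x_{r})_{\infty}}\\ &=\sum_{k_1,\dots,k_n\ge0}\ \prod_{1\leq r<s\leq n}\frac{1-q^{k_{r}-k_{s}}x_{r}/x_{s}}{1-x_{r}/x_{s}}\prod_{r,s=1}^{n}\frac{(qx_{r}/(x_{s}a_{s}))_{k_{r}}}{(qx_{r}/x_{s})_{k_{r}}}\\ &\quad\times\prod_{r=1}^{n}\frac{1-\alpha x_{r}q^{k_{r}+|\boldsymbol{k}|}}{1-\alpha x_{r}}\prod_{r=1}^{n}\frac{(\alpha x_{r})_{|\boldsymbol{k}|}}{(\alpha x_{r}a_{r})_{|\boldsymbol{k}|}}\,q^{\sum_{r=1}^{n}(r-1)k_{r}}\\ &\quad\times\frac{(q/b)_{|\boldsymbol{k}|}}{(\alpha c)_{|\boldsymbol{k}|}}\prod_{r=1}^{n}\frac{(qx_{r}/c)_{k_{r}}}{(\alpha bx_{r})_{k_{r}}}\cdot\Big(\frac{\alpha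 a_{1}\cdots a_{n}bc}{q^{1+n}}\Big)^{|\boldsymbol{k}|}. \end{aligned}$$
   Context: $q$ is a complex number with $0<|q|<1$ and $n\ge1$ is an integer. $(z)_\infty=\prod_{i\ge0}(1-zq^i)$ and $(z)_k=(z)_\infty/(zq^k)_\infty=\prod_{i=0}^{k-1}(1-zq^i)$; $(c_1,\dots,c_p)_k=(c_1)_k\cdots(c_p)_k$ for $k$ a nonnegative integer or $\infty$. $\boldsymbol k=(k_1,\dots,k_n)$ is a multi-index of nonnegative integers and $|\boldsymbol k|=k_1+\cdots+k_n$. *)

theory Defs
  imports "HOL-Analysis.Analysis"
begin

definition qpoch_inf :: "complex \<Rightarrow> complex \<Rightarrow> complex" where
  "qpoch_inf q z = (\<Prod>i. 1 - z * q ^ i)"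

text \<open>The finite product is taken as the definition, since the quotient
  \<open>qpoch_inf q z / qpoch_inf q (z * q ^ k)\<close> is meaningless when its denominator vanishes.\<close>

definition qpoch :: "complex \<Rightarrow> complex \<Rightarrow> nat \<Rightarrow> complex" where
  "qpoch q z k = (\<Prod>i<k. 1 - z * q ^ i)"

text \<open>Multi-indices are the functions on \<open>{1..n}\<close>, extensional (\<open>undefined\<close> outside
  \<open>{1..n}\<close>) so that each multi-index is counted exactly once in a sum.\<close>

definition multi_indices :: "nat \<Rightarrow> (nat \<Rightarrow> nat) set" where
  "multi_indices n = {1..n} \<rightarrow>\<^sub>E UNIV"

definition mi_size :: "nat \<Rightarrow> (nat \<Rightarrow> nat) \<Rightarrow> nat" where
  "mi_size n k = (\<Sum>r=1..n. k r)"

end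

theory Submission
  imports Defs "HOL-Complex_Analysis.Complex_Analysis"
begin

text \<open>
  Put \<open>y\<^sub>s = x\<^sub>s a\<^sub>s\<close>. Up to a factor (\<open>weight\<close>) independent of \<open>c, y\<^sub>1, \<dots>, y\<^sub>n\<close>, the
  summand is a product of one and the same function (\<open>node\<close>) evaluated at each of these \<open>n + 1\<close>
  parameters; hence the sum is symmetric in them.

  In the terminating case \<open>y\<^sub>s = x\<^sub>s q^(m\<^sub>s + 1)\<close>, put \<open>M = m\<^sub>1 + \<dots> + m\<^sub>n\<close>. Multiplied by
  \<open>(\<alpha> c)\<^sub>M\<close>, both sides are polynomials in \<open>c\<close> of degree at most \<open>M\<close>. At the \<open>M\<close> points
  \<open>c = x\<^sub>p q^(j + 1)\<close>, \<open>j < m\<^sub>p\<close>, exchanging \<open>c\<close> and \<open>y\<^sub>p\<close> replaces \<open>m\<^sub>p\<close> by the smaller \<open>j\<close>, so that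
  they agree by induction on \<open>M\<close>. At \<open>c = q^(1 - M) / \<alpha>\<close> only \<open>k = m\<close> contributes, and that
  term is a product that can be evaluated. These are \<open>M + 1\<close> distinct points if \<open>\<alpha>\<close> is generic;
  continuity in \<open>\<alpha>\<close> removes this restriction.

  The general case follows by replacing the special values \<open>x\<^sub>s q^(m\<^sub>s + 1)\<close> by arbitrary \<open>y\<^sub>s\<close>, one
  \<open>s\<close> at a time: both sides are holomorphic in \<open>y\<^sub>s\<close> near \<open>0\<close>, where the special values accumulate.
\<close>

section \<open>Finite q-products\<close>

text \<open>This is \<open>u ^ k\<close> times \<open>qpoch q (q * y / u) k\<close>, with
  \<open>u\<close> cleared from the denominators. As a polynomial in \<open>u\<close> it makes sense
  at \<open>u = 0\<close>, the point around which the analytic continuation takes place. With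
  \<open>y = 1\<close> it supplies the factor \<open>(q/b)_k\<close>.\<close>

definition qfall :: "complex \<Rightarrow> complex \<Rightarrow> complex \<Rightarrow> nat \<Rightarrow> complex" where
  "qfall q u y k = (\<Prod>i<k. u - y * q ^ Suc i)"

lemma qfall_0 [simp]: "qfall q u y 0 = 1"
  by (simp add: qfall_def)

lemma qfall_Suc: "qfall q u y (Suc k) = qfall q u y k * (u - y * q ^ Suc k)"
  by (simp add: qfall_def)

lemma qpoch_0 [simp]: "qpoch q z 0 = 1"
  by (simp add: qpoch_def)

lemma qpoch_Suc: "qpoch q z (Suc k) = qpoch q z k * (1 - z * q ^ k)"
  by (simp add: qpoch_def)

lemma qpoch_add: "qpoch q z (j + k) = qpoch q z j * qpoch q (z * q ^ j) k"
  by (induction k) (simp_all add: qpoch_Suc power_add mult_ac)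

lemma qpoch_nonzero_mono: "qpoch q z k \<noteq> 0 \<Longrightarrow> j \<le> k \<Longrightarrow> qpoch q z j \<noteq> 0"
  by (metis qpoch_add le_add_diff_inverse mult_zero_left)

lemma qpoch_eq_0_iff: "qpoch q z k = 0 \<longleftrightarrow> (\<exists>i<k. z * q ^ i = 1)"
  by (auto simp: qpoch_def)

lemma qfall_eq_qpoch: "u \<noteq> 0 \<Longrightarrow> qfall q u y k = u ^ k * qpoch q (q * y / u) k"
  by (induction k) (simp_all add: qpoch_Suc qfall_Suc field_simps)

lemma qfall_eq_0: "u = y * q ^ Suc j \<Longrightarrow> j < k \<Longrightarrow> qfall q u y k = 0"
  by (auto simp: qfall_def)

text \<open>Each factor on the left is \<open>u * q - y * q ^ Suc i = q * (u - y * q ^ i)\<close>,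
  so up to \<open>q ^ k\<close> the index moves down by one and only the two end factors
  differ.\<close>

lemma qfall_shift: "qfall q (u * q) y k * (u - y * q ^ k) = q ^ k * (u - y) * qfall q u y k"
proof (induction k)
  case (Suc k)
  have "qfall q (u * q) y (Suc k) * (u - y * q ^ Suc k)
      = q * (qfall q (u * q) y k * (u - y * q ^ k)) * (u - y * q ^ Suc k)"
    by (simp add: qfall_Suc algebra_simps)
  also have "\<dots> = q ^ Suc k * (u - y) * qfall q u y (Suc k)"
    unfolding Suc.IH by (simp add: qfall_Suc mult_ac)
  finally show ?case .
qed simp

text \<open>The double product over nodes contains one factor for \<open>(r, s)\<close> and one for
  \<open>(s, r)\<close>. Taken together with their Vandermonde factor, they change only by a power
  of \<open>q\<close> when the arguments are shifted: every induction step on \<open>a\<close> is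
  one use of \<open>qfall_shift\<close>.\<close>

lemma qfall_pair:
  "qfall q (s * q ^ Suc b) r a * qfall q (r * q ^ Suc a) s b * (s * q ^ b - r * q ^ a)
     = (s - r) * qfall q s r a * qfall q r s b * q ^ (a * b + a + b)"
proof (induction a)
  case 0
  have "qfall q (r * q) s b * (s * q ^ b - r) = - (qfall q (r * q) s b * (r - s * q ^ b))"
    by (simp add: algebra_simps)
  also have "\<dots> = (s - r) * qfall q r s b * q ^ b"
    by (subst qfall_shift) (simp add: algebra_simps)
  finally show ?case by simp
next
  case (Suc a)
  let ?u = "r * q ^ Suc a"
  have "qfall q (s * q ^ Suc b) r (Suc a) * qfall q (r * q ^ Suc (Suc a)) s b * (s * q ^ b - r * q ^ Suc a)
      = - (qfall q (s * q ^ Suc b) r a * (s * q ^ Suc b - ?u) * (qfall q (?u * q) s b * (?u - s * q ^ b)))"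
    by (simp add: qfall_Suc algebra_simps)
  also have "\<dots> = (qfall q (s * q ^ Suc b) r a * qfall q ?u s b * (s * q ^ b - r * q ^ a))
                     * (q ^ Suc b * (s - ?u))"
    by (subst qfall_shift) (simp add: algebra_simps)
  also have "\<dots> = (s - r) * qfall q s r (Suc a) * qfall q r s b * q ^ (Suc a * b + Suc a + b)"
    by (subst Suc.IH) (simp add: qfall_Suc power_add mult_ac)
  finally show ?case .
qed

text \<open>The triangular number m(m+1)/2, kept as a sum so that no division of naturals
  occurs.\<close>

definition tri :: "nat \<Rightarrow> nat" where "tri m = (\<Sum>i<m. Suc i)"

lemma tri_add: "tri (a + b) = tri a + tri b + a * b"
  by (induction b) (simp_all add: tri_def)

lemma two_tri: "2 * tri m = m * m + m"
  by (induction m) (simp_all add: tri_def)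

lemma prod_power_Suc: "(\<Prod>i<m. q ^ Suc i) = q ^ tri m" for q :: complex
  by (simp add: tri_def power_sum)

text \<open>Factor \<open>i\<close> is \<open>- y * q ^ Suc i\<close> times
  \<open>1 - q ^ (m - i)\<close>, and the second factors run through \<open>qpoch q q m\<close>
  backwards.\<close>

lemma qfall_diag: "qfall q (y * q ^ Suc m) y m = (- y) ^ m * q ^ tri m * qpoch q q m"
proof -
  have "qfall q (y * q ^ Suc m) y m = (\<Prod>i<m. (- y * q ^ Suc i) * (1 - q ^ (m - i)))"
    unfolding qfall_def
    by (intro prod.cong) (auto simp: algebra_simps simp flip: power_add)
  also have "\<dots> = (- y) ^ m * q ^ tri m * (\<Prod>i<m. 1 - q ^ (m - i))"
    by (simp only: prod.distrib prod_power_Suc) simp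
  also have "(\<Prod>i<m. 1 - q ^ (m - i)) = (\<Prod>i<m. 1 - q * q ^ i)"
    by (subst prod.nat_diff_reindex [symmetric]) (auto intro!: prod.cong simp: Suc_diff_Suc simp flip: power_Suc)
  finally show ?thesis by (simp add: qpoch_def)
qed

text \<open>In reversed order the factors are \<open>1 - b / q ^ Suc i\<close>; the power
  \<open>q ^ tri M\<close> clears their denominators one by one.\<close>

lemma qpoch_reverse:
  assumes "q \<noteq> 0"
  shows "qpoch q (b / q ^ M) M * q ^ tri M = (- 1) ^ M * qfall q b 1 M"
proof -
  have "qpoch q (b / q ^ M) M = (\<Prod>i<M. 1 - b / q ^ M * q ^ (M - Suc i))"
    unfolding qpoch_def by (subst prod.nat_diff_reindex [symmetric]) simp
  also have "\<dots> = (\<Prod>i<M. 1 - b / q ^ Suc i)"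
  proof (intro prod.cong refl)
    fix i assume "i \<in> {..<M}"
    then have "q ^ M = q ^ Suc i * q ^ (M - Suc i)"
      by (simp flip: power_add power_Suc)
    then show "1 - b / q ^ M * q ^ (M - Suc i) = 1 - b / q ^ Suc i"
      using assms by simp
  qed
  finally have "qpoch q (b / q ^ M) M * q ^ tri M = (\<Prod>i<M. (1 - b / q ^ Suc i) * q ^ Suc i)"
    by (simp only: prod.distrib prod_power_Suc)
  also have "\<dots> = (\<Prod>i<M. - 1 * (b - 1 * q ^ Suc i))"
    using assms by (intro prod.cong) (auto simp: field_simps)
  also have "\<dots> = (- 1) ^ M * qfall q b 1 M"
    by (simp only: prod.distrib qfall_def) simp
  finally show ?thesis .
qed

text \<open>The Vandermonde product of the points \<open>x r * q ^ k r\<close> divided by that of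
  the points \<open>x r\<close>. It already contains the factor
  \<open>q ^ (\<Sum>r=1..n. (r - 1) * k r)\<close> of the series, as \<open>vand_eq\<close>
  shows.\<close>

definition vand :: "complex \<Rightarrow> (nat \<Rightarrow> complex) \<Rightarrow> nat \<Rightarrow> (nat \<Rightarrow> nat) \<Rightarrow> complex" where
  "vand q x n k = (\<Prod>r=1..n. \<Prod>s\<in>{r<..n}. (x s * q ^ k s - x r * q ^ k r) / (x s - x r))"

lemma mi_size_Suc: "mi_size (Suc n) k = mi_size n k + k (Suc n)"
  by (simp add: mi_size_def)

lemma vand_Suc:
  "vand q x (Suc n) k = vand q x n k *
     (\<Prod>r=1..n. (x (Suc n) * q ^ k (Suc n) - x r * q ^ k r) / (x (Suc n) - x r))"
proof -
  have *: "{r<..Suc n} = insert (Suc n) {r<..n}" if "r \<le> n" for r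
    using that by auto
  have "vand q x (Suc n) k = (\<Prod>r=1..n. \<Prod>s\<in>{r<..Suc n}. (x s * q ^ k s - x r * q ^ k r) / (x s - x r))"
    by (simp add: vand_def)
  also have "\<dots> = (\<Prod>r=1..n. (x (Suc n) * q ^ k (Suc n) - x r * q ^ k r) / (x (Suc n) - x r) *
       (\<Prod>s\<in>{r<..n}. (x s * q ^ k s - x r * q ^ k r) / (x s - x r)))"
    by (intro prod.cong) (auto simp: *)
  finally show ?thesis by (simp only: prod.distrib vand_def mult.commute)
qed

lemma prod_square_Suc:
  fixes D :: "nat \<Rightarrow> nat \<Rightarrow> complex"
  shows "(\<Prod>r=1..Suc n. \<Prod>s=1..Suc n. D r s) =
    (\<Prod>r=1..n. \<Prod>s=1..n. D r s) * (\<Prod>r=1..n. D r (Suc n) * D (Suc n) r) * D (Suc n) (Suc n)"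
  by (simp add: prod.distrib mult_ac)

text \<open>Induction on \<open>n\<close>: a new variable contributes a diagonal factor, given by
  \<open>qfall_diag\<close>, and one pair with each old variable, given by
  \<open>qfall_pair\<close>; \<open>tri_add\<close> collects the exponents. The extra
  \<open>q ^ mi_size n m\<close> on the left avoids the exponent \<open>n - 1\<close>.\<close>

lemma vand_core:
  assumes "0 < norm q" "norm q < 1"
    and "\<And>r. r \<in> {1..n} \<Longrightarrow> x r \<noteq> 0"
    and "\<And>r s i. r \<in> {1..n} \<Longrightarrow> s \<in> {1..n} \<Longrightarrow> r \<noteq> s \<Longrightarrow> x r \<noteq> x s * q ^ i"
  shows "vand q x n m * (\<Prod>r=1..n. \<Prod>s=1..n. qfall q (x s * q ^ Suc (m s)) (x r) (m r) / qpoch q (q * x r / x s) (m r))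
      * q ^ mi_size n m
    = (- (\<Prod>r=1..n. x r)) ^ mi_size n m * q ^ (tri (mi_size n m) + n * mi_size n m)"
  using assms(3,4)
proof (induction n)
  case 0
  show ?case by (simp add: vand_def mi_size_def tri_def)
next
  case (Suc n)
  define M where "M = mi_size n m"
  define p where "p = m (Suc n)"
  define X where "X = (\<Prod>r=1..n. x r)"
  define y where "y = x (Suc n)"
  define D where "D = (\<lambda>r s. qfall q (x s * q ^ Suc (m s)) (x r) (m r) / qpoch q (q * x r / x s) (m r))"
  have q0: "q \<noteq> 0" using assms by auto
  have IH: "vand q x n m * (\<Prod>r=1..n. \<Prod>s=1..n. D r s) * q ^ M = (- X) ^ M * q ^ (tri M + n * M)"
    unfolding D_def M_def X_def by (rule Suc.IH) (use Suc.prems in auto)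
  have qpow: "q * q ^ i \<noteq> 1" for i
    using power_Suc_less_one[of "norm q" i] assms
    by (metis norm_one norm_power order_less_irrefl power_Suc norm_ge_zero less_irrefl zero_less_norm_iff)
  have y0: "y \<noteq> 0" using Suc.prems(1)[of "Suc n"] by (simp add: y_def)
  have diag: "D (Suc n) (Suc n) = (- y) ^ p * q ^ tri p"
  proof -
    have "qpoch q q p \<noteq> 0" using qpow by (auto simp: qpoch_eq_0_iff)
    then show ?thesis using y0
      unfolding D_def y_def [symmetric] p_def [symmetric] qfall_diag by simp
  qed
  have pair: "D r (Suc n) * D (Suc n) r * ((y * q ^ p - x r * q ^ m r) / (y - x r))
       = y ^ m r * x r ^ p * q ^ (m r * p + m r + p)" if r: "r \<in> {1..n}" for r
  proof -
    have x0: "x r \<noteq> 0" and ne: "x r \<noteq> y * q ^ i" "y \<noteq> x r * q ^ i" for i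
      using Suc.prems(1)[of r] Suc.prems(2)[of r "Suc n" i] Suc.prems(2)[of "Suc n" r i] r by (auto simp: y_def)
    have d1: "qfall q y (x r) (m r) \<noteq> 0" "qfall q (x r) y p \<noteq> 0" "y - x r \<noteq> 0"
      using ne ne[of 0] by (auto simp: qfall_def simp del: power_Suc)
    \<comment> \<open>In this form the two denominators are exactly the products on the right of
      \<open>qfall_pair\<close>, so they cancel.\<close>
    have e: "qpoch q (q * x r / y) (m r) = qfall q y (x r) (m r) / y ^ m r"
            "qpoch q (q * y / x r) p = qfall q (x r) y p / x r ^ p"
      using x0 y0 by (simp_all add: qfall_eq_qpoch)
    have "D r (Suc n) * D (Suc n) r * ((y * q ^ p - x r * q ^ m r) / (y - x r))
       = (qfall q (y * q ^ Suc p) (x r) (m r) * qfall q (x r * q ^ Suc (m r)) y p * (y * q ^ p - x r * q ^ m r))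
          * (y ^ m r * x r ^ p) / (qfall q y (x r) (m r) * qfall q (x r) y p * (y - x r))"
      unfolding D_def y_def [symmetric] p_def [symmetric] e by (simp add: field_simps)
    also have "\<dots> = y ^ m r * x r ^ p * q ^ (m r * p + m r + p)"
      unfolding qfall_pair using d1 by (simp add: field_simps)
    finally show ?thesis .
  qed
  have "vand q x (Suc n) m * (\<Prod>r=1..Suc n. \<Prod>s=1..Suc n. D r s)
     = vand q x n m * (\<Prod>r=1..n. \<Prod>s=1..n. D r s) * D (Suc n) (Suc n) *
        (\<Prod>r=1..n. D r (Suc n) * D (Suc n) r * ((y * q ^ p - x r * q ^ m r) / (y - x r)))"
    unfolding vand_Suc prod_square_Suc prod.distrib y_def p_def by (simp only: mult_ac)
  also have "(\<Prod>r=1..n. D r (Suc n) * D (Suc n) r * ((y * q ^ p - x r * q ^ m r) / (y - x r)))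
     = (\<Prod>r=1..n. y ^ m r * x r ^ p * q ^ (m r * p + m r + p))"
    using pair by (intro prod.cong) auto
  also have "\<dots> = y ^ M * X ^ p * q ^ (M * p + M + n * p)"
    by (simp add: prod.distrib M_def X_def mi_size_def power_sum power_add sum_distrib_right mult.commute[of n p]
         flip: prod_power_distrib power_mult)
  finally have split: "vand q x (Suc n) m * (\<Prod>r=1..Suc n. \<Prod>s=1..Suc n. D r s)
    = vand q x n m * (\<Prod>r=1..n. \<Prod>s=1..n. D r s) * D (Suc n) (Suc n) *
       (y ^ M * X ^ p * q ^ (M * p + M + n * p))" .
  have "vand q x (Suc n) m * (\<Prod>r=1..Suc n. \<Prod>s=1..Suc n. D r s) * q ^ mi_size (Suc n) m
    = (vand q x n m * (\<Prod>r=1..n. \<Prod>s=1..n. D r s) * q ^ M) * q ^ p * D (Suc n) (Suc n) *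
       (y ^ M * X ^ p * q ^ (M * p + M + n * p))"
    unfolding split by (simp add: mi_size_Suc M_def p_def power_add)
  also have "\<dots> = (- 1) ^ M * (- 1) ^ p * (X * y) ^ M * (X * y) ^ p
       * q ^ (tri M + n * M + p + tri p + M * p + M + n * p)"
    unfolding IH diag by (simp add: power_add power_mult_distrib mult_ac power_minus[of X] power_minus[of y])
  also have "\<dots> = (- (X * y)) ^ (M + p) * q ^ (tri (M + p) + Suc n * (M + p))"
    by (simp add: tri_add algebra_simps power_minus[of "X * y"] power_add)
  finally show ?case
    by (simp add: D_def M_def p_def mi_size_Suc X_def y_def)
qed

section \<open>The terminating sum for generic \<open>\<alpha>\<close>\<close>

text \<open>Since \<open>a r = y r / x r\<close>, the argument of the series is \<alpha>/(q^(1+n)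
  x_1...x_n) times b, c and all y_r. The power of \<open>b\<close> is absorbed by
  \<open>qfall q b 1\<close>, those of \<open>c\<close> and the y_r by \<open>node\<close>; only the
  first factor remains here.\<close>

definition weight :: "complex \<Rightarrow> complex \<Rightarrow> complex \<Rightarrow> (nat \<Rightarrow> complex) \<Rightarrow> nat \<Rightarrow> (nat \<Rightarrow> nat) \<Rightarrow> complex" where
  "weight q \<alpha> b x n k =
     vand q x n k / (\<Prod>r=1..n. \<Prod>s=1..n. qpoch q (q * x r / x s) (k r))
     * (\<Prod>r=1..n. (1 - \<alpha> * x r * q ^ (k r + mi_size n k)) * qpoch q (\<alpha> * x r) (mi_size n k) / (1 - \<alpha> * x r))
     * qfall q b 1 (mi_size n k) / (\<Prod>r=1..n. qpoch q (\<alpha> * b * x r) (k r))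
     * (\<alpha> / (q ^ (1 + n) * (\<Prod>r=1..n. x r))) ^ mi_size n k"

text \<open>With the power \<open>y ^ mi_size n k\<close> absorbed, the numerator is a polynomial in
  \<open>y\<close>. This serves both the interpolation in \<open>c\<close> and the continuation from
  \<open>y = 0\<close>.\<close>

definition node :: "complex \<Rightarrow> complex \<Rightarrow> (nat \<Rightarrow> complex) \<Rightarrow> nat \<Rightarrow> complex \<Rightarrow> (nat \<Rightarrow> nat) \<Rightarrow> complex" where
  "node q \<alpha> x n y k = (\<Prod>r=1..n. qfall q y (x r) (k r)) / qpoch q (\<alpha> * y) (mi_size n k)"

lemma node_eq_0:
  assumes "s \<in> {1..n}" "m < k s"
  shows "node q \<alpha> x n (x s * q ^ Suc m) k = 0"
  using assms qfall_eq_0[of "x s * q ^ Suc m" "x s" q m "k s"] by (force simp: node_def)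

lemma degree_prod_bound:
  assumes "finite I" "\<And>i. i \<in> I \<Longrightarrow> degree (f i) \<le> g i"
  shows "degree (\<Prod>i\<in>I. f i) \<le> (\<Sum>i\<in>I. g i)"
  using degree_prod_sum_le[OF assms(1), of f] sum_mono[of I "degree \<circ> f" g] assms(2) by fastforce

lemma degree_prod_linear:
  assumes "\<And>i. degree (f i) \<le> 1"
  shows "degree (\<Prod>i<k. f i) \<le> k"
  using degree_prod_bound[of "{..<k}" f "\<lambda>_. 1"] assms by simp

text \<open>As \<open>r\<close> and \<open>s\<close> may be exchanged, the last assumption says that
  no ratio of two different nodes is an integral power of \<open>q\<close>.\<close>

locale generic_nodes =
  fixes q :: complex and x :: "nat \<Rightarrow> complex" and n :: nat
  assumes q_pos: "0 < norm q" and q_less_1: "norm q < 1"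
    and x_nonzero: "\<And>r. r \<in> {1..n} \<Longrightarrow> x r \<noteq> 0"
    and x_generic: "\<And>r s i. r \<in> {1..n} \<Longrightarrow> s \<in> {1..n} \<Longrightarrow> r \<noteq> s \<Longrightarrow> x r \<noteq> x s * q ^ i"
begin

lemma q_nonzero: "q \<noteq> 0"
  using q_pos by auto

lemma q_power_inj: "q ^ i = q ^ j \<longleftrightarrow> i = j"
proof
  assume "q ^ i = q ^ j"
  then have "norm q ^ i = norm q ^ j" by (metis norm_power)
  then show "i = j"
    using q_pos q_less_1 power_inject_exp' by (metis linorder_neqE_nat order_less_irrefl power_strict_decreasing)
qed simp

lemma node_denominator:
  assumes "r \<in> {1..n}" "s \<in> {1..n}"
  shows "qpoch q (q * x r / x s) j \<noteq> 0"
proof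
  assume "qpoch q (q * x r / x s) j = 0"
  then obtain i where "q * x r / x s * q ^ i = 1"
    by (auto simp: qpoch_eq_0_iff)
  then have "x s = x r * q ^ Suc i"
    using x_nonzero[OF assms(2)] by (simp add: field_simps)
  then show False
    using x_generic[of s r "Suc i"] x_nonzero[OF assms(1)] q_power_inj[of "Suc i" 0] assms
    by (cases "s = r") (auto simp del: power_Suc)
qed

text \<open>This is the interpolation condition at the extra point, where \<alpha> c q^(M-1) = 1.
  The denominator \<open>qpoch q (\<alpha> * c) M\<close> of \<open>node\<close> at \<open>c\<close>
  vanishes there for positive \<open>M\<close>; it is cleared beforehand, so only the numerator of
  that node appears. The Vandermonde part comes from \<open>vand_core\<close>, and the factors
  containing \<alpha> telescope.\<close>

lemma top_summand:
  fixes m :: "nat \<Rightarrow> nat"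
  assumes "\<alpha> \<noteq> 0" and gen: "\<And>r i. r \<in> {1..n} \<Longrightarrow> \<alpha> * x r * q ^ i \<noteq> 1"
  defines "M \<equiv> mi_size n m" and "c \<equiv> q / (\<alpha> * q ^ mi_size n m)"
  shows "weight q \<alpha> b x n m * (\<Prod>s=1..n. node q \<alpha> x n (x s * q ^ Suc (m s)) m)
           * (\<Prod>r=1..n. qfall q c (x r) (m r))
       = (\<Prod>r=1..n. qpoch q (\<alpha> * q * x r) (m r) / qpoch q (\<alpha> * b * x r) (m r)) * qpoch q (\<alpha> * b * c / q) M"
proof -
  define X where "X = (\<Prod>r=1..n. x r)"
  define V where "V = vand q x n m"
  define F where "F = (\<Prod>r=1..n. \<Prod>s=1..n. qfall q (x s * q ^ Suc (m s)) (x r) (m r))"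
  define E where "E = (\<Prod>r=1..n. \<Prod>s=1..n. qpoch q (q * x r / x s) (m r))"
  define U where "U = (\<Prod>r=1..n. qpoch q (\<alpha> * q * x r) (m r))"
  define W where "W = (\<Prod>r=1..n. qpoch q (\<alpha> * b * x r) (m r))"
  define T where "T = (\<Prod>r=1..n. (1 - \<alpha> * x r * q ^ (m r + M)) * qpoch q (\<alpha> * x r) M / (1 - \<alpha> * x r))"
  define Q where "Q = (\<Prod>r=1..n. qpoch q (\<alpha> * (x r * q ^ Suc (m r))) M)"
  define R where "R = (\<Prod>r=1..n. qfall q c (x r) (m r))"
  define Z where "Z = qpoch q (b / q ^ M) M"
  have c0: "c \<noteq> 0" using assms q_nonzero by (simp add: c_def)
  have X0: "X \<noteq> 0" using x_nonzero by (simp add: X_def)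
  have bc: "\<alpha> * b * c / q = b / q ^ M"
    using assms(1) q_nonzero by (simp add: c_def M_def)
  have VF: "V * (F / E) * q ^ M = (- X) ^ M * q ^ (tri M + n * M)"
    using vand_core[OF q_pos q_less_1 x_nonzero x_generic, where m = m]
    by (simp add: V_def F_def E_def M_def X_def prod_dividef)
  have TR: "T * R / Q = c ^ M * U"
  proof -
    have "(1 - \<alpha> * x r * q ^ (m r + M)) * qpoch q (\<alpha> * x r) M / (1 - \<alpha> * x r)
       * qfall q c (x r) (m r) / qpoch q (\<alpha> * (x r * q ^ Suc (m r))) M
       = c ^ m r * qpoch q (\<alpha> * q * x r) (m r)" (is "?L = ?R") if r: "r \<in> {1..n}" for r
    proof -
      define z where "z = \<alpha> * x r"
      have z: "z * q ^ i \<noteq> 1" for i using gen[OF r] by (simp add: z_def)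
      have nz: "1 - z \<noteq> 0" "qpoch q (z * q ^ Suc (m r)) M \<noteq> 0"
      proof -
        show "1 - z \<noteq> 0" using z[of 0] by simp
        have "z * q ^ Suc (m r) * q ^ i \<noteq> 1" for i
          using z[of "Suc (m r) + i"] by (simp add: power_add mult_ac)
        then show "qpoch q (z * q ^ Suc (m r)) M \<noteq> 0" by (auto simp: qpoch_eq_0_iff)
      qed
      have cz: "qfall q c (x r) (m r) = c ^ m r * qpoch q (z * q ^ M) (m r)"
      proof -
        \<comment> \<open>The choice of \<open>c\<close> makes the node at \<open>c\<close> continue
          \<open>qpoch q z M\<close> by \<open>m r\<close> further factors.\<close>
        have "q * x r / c = z * q ^ M" using assms(1) q_nonzero by (simp add: c_def M_def z_def)
        then show ?thesis using c0 by (simp add: qfall_eq_qpoch)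
      qed
      \<comment> \<open>The product of the first \<open>Suc (m r + M)\<close> factors is split in
        two ways: after \<open>M\<close>, with the last factor apart, and after the first factor and
        \<open>m r\<close> more.\<close>
      have "(1 - z * q ^ (m r + M)) * (qpoch q z M * qpoch q (z * q ^ M) (m r)) = qpoch q z (Suc (m r + M))"
        by (simp add: qpoch_Suc qpoch_add [symmetric] add.commute)
      also have "Suc (m r + M) = 1 + m r + M" by simp
      also have "qpoch q z (1 + m r + M) = (1 - z) * qpoch q (z * q) (m r) * qpoch q (z * q ^ Suc (m r)) M"
        unfolding qpoch_add by (simp add: qpoch_Suc)
      finally have *: "(1 - z * q ^ (m r + M)) * (qpoch q z M * qpoch q (z * q ^ M) (m r))
         = (1 - z) * qpoch q (z * q) (m r) * qpoch q (z * q ^ Suc (m r)) M" .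
      have "?L = c ^ m r * ((1 - z * q ^ (m r + M)) * (qpoch q z M * qpoch q (z * q ^ M) (m r)))
          / ((1 - z) * qpoch q (z * q ^ Suc (m r)) M)"
        unfolding cz z_def by (simp add: mult_ac)
      also have "\<dots> = c ^ m r * qpoch q (z * q) (m r)"
        unfolding * using nz by (simp add: divide_simps)
      finally show ?thesis by (simp add: z_def mult_ac)
    qed
    then have "T * R / Q = (\<Prod>r=1..n. c ^ m r * qpoch q (\<alpha> * q * x r) (m r))"
      unfolding T_def R_def Q_def prod.distrib [symmetric] prod_dividef [symmetric]
      by (intro prod.cong) auto
    also have "\<dots> = c ^ M * U"
      by (simp add: prod.distrib U_def M_def mi_size_def power_sum)
    finally show ?thesis .
  qed
  have B: "qfall q b 1 M = (- 1) ^ M * (Z * q ^ tri M)"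
    unfolding Z_def qpoch_reverse[OF q_nonzero] by (simp flip: power_mult_distrib)
  have nodes: "(\<Prod>s=1..n. node q \<alpha> x n (x s * q ^ Suc (m s)) m) = F / Q"
  proof -
    have "F = (\<Prod>s=1..n. \<Prod>r=1..n. qfall q (x s * q ^ Suc (m s)) (x r) (m r))"
      unfolding F_def by (rule prod.swap)
    then show ?thesis by (simp only: node_def prod_dividef Q_def M_def)
  qed
  \<comment> \<open>The surplus is exactly the \<open>q ^ M\<close> introduced by
    \<open>vand_core\<close>, which cancels at the end.\<close>
  have exponent: "tri M + n * M + tri M = (n * M + M * M) + M"
    using two_tri[of M] by (simp add: algebra_simps)
  have "weight q \<alpha> b x n m * (F / Q) * R * q ^ M
      = (V * (F / E) * q ^ M) * (T * R / Q) * qfall q b 1 M / W * (\<alpha> / (q ^ (1 + n) * X)) ^ M"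
    unfolding weight_def V_def [symmetric] E_def [symmetric] M_def [symmetric] T_def [symmetric]
      W_def [symmetric] X_def [symmetric] by (simp add: mult_ac)
  also have "\<dots> = (- 1) ^ M * (- X) ^ M * q ^ (tri M + n * M + tri M) * (c * (\<alpha> / (q ^ (1 + n) * X))) ^ M * U / W * Z"
    unfolding VF TR B power_mult_distrib power_add by simp
  also have "c * (\<alpha> / (q ^ (1 + n) * X)) = 1 / (q ^ n * q ^ M * X)"
    using assms(1) q_nonzero by (simp add: c_def M_def)
  also have "(- 1) ^ M * (- X) ^ M * q ^ (tri M + n * M + tri M) * (1 / (q ^ n * q ^ M * X)) ^ M
     = q ^ (tri M + n * M + tri M) / q ^ (n * M + M * M)"
  proof -
    have "(- 1) ^ M * (- X) ^ M = X ^ M" by (simp flip: power_mult_distrib)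
    moreover have "(1 / (q ^ n * q ^ M * X)) ^ M = 1 / (q ^ (n * M + M * M) * X ^ M)"
      by (simp add: power_divide power_mult_distrib power_add power_mult)
    ultimately show ?thesis using X0 by simp
  qed
  also have "\<dots> = q ^ M"
    unfolding exponent power_add[of q "n * M + M * M"] using q_nonzero by simp
  finally have "(weight q \<alpha> b x n m * (F / Q) * R) * q ^ M = (U / W * Z) * q ^ M"
    by (simp add: mult_ac)
  then have "weight q \<alpha> b x n m * (F / Q) * R = U / W * Z"
    using q_nonzero by (subst (asm) mult_right_cancel) auto
  then show ?thesis
    unfolding nodes bc M_def [symmetric] R_def Z_def U_def W_def prod_dividef .
qed

text \<open>The box \<open>{..L}\<close> does not depend on \<open>m\<close>, so that the induction
  hypothesis for a smaller \<open>m\<close> is a sum over the same set; \<open>c\<close> is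
  generalised because the exchange with a node changes it too.\<close>

lemma terminating_generic:
  assumes "\<alpha> \<noteq> 0" and gen: "\<And>r i. r \<in> {1..n} \<Longrightarrow> \<alpha> * x r * q ^ i \<noteq> 1"
  assumes "m \<in> {1..n} \<rightarrow>\<^sub>E {..L}"
    and "\<And>r. r \<in> {1..n} \<Longrightarrow> qpoch q (\<alpha> * b * x r) (m r) \<noteq> 0"
    and "qpoch q (\<alpha> * c) (mi_size n m) \<noteq> 0"
  shows "(\<Sum>k\<in>{1..n} \<rightarrow>\<^sub>E {..L}. weight q \<alpha> b x n k * (node q \<alpha> x n c k * (\<Prod>s=1..n. node q \<alpha> x n (x s * q ^ Suc (m s)) k)))
    = qpoch q (\<alpha> * b * c / q) (mi_size n m) / qpoch q (\<alpha> * c) (mi_size n m)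
      * (\<Prod>r=1..n. qpoch q (\<alpha> * q * x r) (m r) / qpoch q (\<alpha> * b * x r) (m r))"
  using assms(3-)
proof (induction "mi_size n m" arbitrary: m c rule: less_induct)
  case (less m c)
  define B where "B = {1..n} \<rightarrow>\<^sub>E {..L}"
  define M where "M = mi_size n m"
  define R where "R = (\<lambda>r j. qpoch q (\<alpha> * q * x r) j / qpoch q (\<alpha> * b * x r) j)"
  define C where "C = (\<Prod>r=1..n. R r (m r))"
  define w where "w = (\<lambda>k. weight q \<alpha> b x n k * (\<Prod>s=1..n. node q \<alpha> x n (x s * q ^ Suc (m s)) k))"
  define S where "S = {k \<in> B. \<forall>r\<in>{1..n}. k r \<le> m r}"
  \<comment> \<open>\<open>P\<close> is the difference of the two sides times
    \<open>qpoch q (\<alpha> * c) M\<close>, as a polynomial in \<open>c\<close>. The second product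
    is what remains of this multiplier after cancelling the denominator of the node at
    \<open>c\<close>.\<close>
  define P where "P = (\<Sum>k\<in>S. smult (w k) ((\<Prod>r=1..n. \<Prod>i<k r. [:- (x r * q ^ Suc i), 1:])
      * (\<Prod>i<M - mi_size n k. [:1, - (\<alpha> * q ^ (mi_size n k + i)):])))
      - smult C (\<Prod>i<M. [:1, - (\<alpha> * b / q * q ^ i):])"
  have fin: "finite B" "finite S" unfolding B_def S_def by (auto intro!: finite_PiE)
  have m_in: "m \<in> S" using less.prems(1) by (auto simp: S_def B_def)
  have size_le: "mi_size n k \<le> M" if "k \<in> S" for k
    using that unfolding mi_size_def M_def S_def by (auto intro: sum_mono)
  have size_less: "mi_size n k < M" if "k \<in> S" "k \<noteq> m" for k
  proof -
    have "\<exists>r\<in>{1..n}. k r \<noteq> m r"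
    proof (rule ccontr)
      assume "\<not> (\<exists>r\<in>{1..n}. k r \<noteq> m r)"
      then have "k = m"
        using that m_in unfolding S_def B_def by (intro PiE_ext[of k "{1..n}" "\<lambda>_. {..L}" m]) auto
      then show False using that by simp
    qed
    then show ?thesis
      using that unfolding mi_size_def M_def S_def
      by (intro sum_strict_mono_ex1) (auto simp: order_le_less)
  qed
  have w_0: "w k = 0" if "k \<in> B - S" for k
  proof -
    have "\<not> (\<forall>r\<in>{1..n}. k r \<le> m r)" using that by (simp add: S_def)
    then obtain r where "r \<in> {1..n}" "m r < k r" by (meson not_le)
    then show ?thesis using node_eq_0[of r n "m r" k q \<alpha> x]
      by (auto simp: w_def simp del: power_Suc)
  qed
  have poly_P: "poly P d = (\<Sum>k\<in>S. w k * ((\<Prod>r=1..n. qfall q d (x r) (k r)) * qpoch q (\<alpha> * d * q ^ mi_size n k) (M - mi_size n k)))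
     - C * qpoch q (\<alpha> * b * d / q) M" for d
    by (simp add: P_def poly_sum poly_prod qfall_def qpoch_def power_add mult_ac)
  have sum_eq: "(\<Sum>k\<in>B. weight q \<alpha> b x n k * (node q \<alpha> x n d k * (\<Prod>s=1..n. node q \<alpha> x n (x s * q ^ Suc (m s)) k)))
     = (poly P d + C * qpoch q (\<alpha> * b * d / q) M) / qpoch q (\<alpha> * d) M"
    if "qpoch q (\<alpha> * d) M \<noteq> 0" for d
  proof -
    have "(\<Sum>k\<in>B. weight q \<alpha> b x n k * (node q \<alpha> x n d k * (\<Prod>s=1..n. node q \<alpha> x n (x s * q ^ Suc (m s)) k)))
        = (\<Sum>k\<in>B. w k * node q \<alpha> x n d k)"
      by (simp add: w_def mult_ac)
    also have "\<dots> = (\<Sum>k\<in>S. w k * node q \<alpha> x n d k)"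
      using fin w_0 by (intro sum.mono_neutral_right) (auto simp: S_def)
    also have "\<dots> = (\<Sum>k\<in>S. w k * ((\<Prod>r=1..n. qfall q d (x r) (k r)) * qpoch q (\<alpha> * d * q ^ mi_size n k) (M - mi_size n k))
         / qpoch q (\<alpha> * d) M)"
    proof (intro sum.cong refl)
      fix k assume "k \<in> S"
      then have "qpoch q (\<alpha> * d) M = qpoch q (\<alpha> * d) (mi_size n k) * qpoch q (\<alpha> * d * q ^ mi_size n k) (M - mi_size n k)"
        by (simp add: size_le flip: qpoch_add)
      then show "w k * node q \<alpha> x n d k = w k * ((\<Prod>r=1..n. qfall q d (x r) (k r)) * qpoch q (\<alpha> * d * q ^ mi_size n k) (M - mi_size n k))
         / qpoch q (\<alpha> * d) M"
        using that by (auto simp: node_def)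
    qed
    finally show ?thesis by (simp add: poly_P sum_divide_distrib)
  qed
  have degree_P: "degree P \<le> M"
    unfolding P_def
  proof (intro degree_diff_le degree_sum_le fin order.trans[OF degree_smult_le])
    fix k assume "k \<in> S"
    have "degree ((\<Prod>r=1..n. \<Prod>i<k r. [:- (x r * q ^ Suc i), 1:])
      * (\<Prod>i<M - mi_size n k. [:1, - (\<alpha> * q ^ (mi_size n k + i)):])) \<le> mi_size n k + (M - mi_size n k)"
      unfolding mi_size_def
      by (rule order.trans[OF degree_mult_le add_mono]; intro degree_prod_bound degree_prod_linear) auto
    then show "degree ((\<Prod>r=1..n. \<Prod>i<k r. [:- (x r * q ^ Suc i), 1:])
      * (\<Prod>i<M - mi_size n k. [:1, - (\<alpha> * q ^ (mi_size n k + i)):])) \<le> M"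
      using size_le[OF \<open>k \<in> S\<close>] by simp
  next
    show "degree (\<Prod>i<M. [:1, - (\<alpha> * b / q * q ^ i):]) \<le> M"
      by (intro degree_prod_linear) auto
  qed
  define f where "f = (\<lambda>(p, j). x p * q ^ Suc j)"
  define A where "A = (SIGMA p:{1..n}. {..<m p})"
  define c0 where "c0 = q / (\<alpha> * q ^ M)"
  have root_f: "poly P (x p * q ^ Suc j) = 0" if p: "p \<in> {1..n}" and j: "j < m p" for p j
  proof -
    \<comment> \<open>The values \<open>d\<close> for \<open>c\<close> and \<open>d'\<close> for the
      node \<open>p\<close> trade places. The node \<open>p\<close> then terminates at
      \<open>j\<close> instead of \<open>m p\<close>, and \<open>d'\<close> plays the part of
      \<open>c\<close>.\<close>
    define m' where "m' = m(p := j)"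
    define d where "d = x p * q ^ Suc j"
    define d' where "d' = x p * q ^ Suc (m p)"
    define M' where "M' = mi_size n m'"
    have M': "M' + m p = M + j"
      unfolding M'_def M_def mi_size_def sum.remove[OF finite_atLeastAtMost p] by (simp add: m'_def)
    have d_nz: "qpoch q (\<alpha> * (x p * q ^ i)) N \<noteq> 0" for i N
      using gen[OF p, of "i + _"] by (auto simp: qpoch_eq_0_iff power_add mult_ac)
    have b_nz: "qpoch q (\<alpha> * b * x r) (m' r) \<noteq> 0" if "r \<in> {1..n}" for r
      using less.prems(2)[OF that] j qpoch_nonzero_mono[of q "\<alpha> * b * x p" "m p" j]
      by (auto simp: m'_def)
    have swap: "node q \<alpha> x n d k * (\<Prod>s=1..n. node q \<alpha> x n (x s * q ^ Suc (m s)) k)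
        = node q \<alpha> x n d' k * (\<Prod>s=1..n. node q \<alpha> x n (x s * q ^ Suc (m' s)) k)" for k
      unfolding prod.remove[OF finite_atLeastAtMost p]
      by (simp add: m'_def d_def d'_def)
    have "(\<Sum>k\<in>B. weight q \<alpha> b x n k * (node q \<alpha> x n d k * (\<Prod>s=1..n. node q \<alpha> x n (x s * q ^ Suc (m s)) k)))
        = qpoch q (\<alpha> * b * d' / q) M' / qpoch q (\<alpha> * d') M' * (\<Prod>r=1..n. R r (m' r))"
      unfolding swap B_def M'_def R_def
    proof (rule less.hyps)
      show "mi_size n m' < mi_size n m" using M' j by (simp add: M'_def M_def)
      show "m' \<in> {1..n} \<rightarrow>\<^sub>E {..L}"
        using less.prems(1) p j order.trans[of j "m p" L] by (auto simp: m'_def PiE_iff extensional_def)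
    qed (use b_nz d_nz in \<open>auto simp: d'_def simp del: power_Suc\<close>)
    also have "\<dots> = qpoch q (\<alpha> * b * d / q) M / qpoch q (\<alpha> * d) M * (\<Prod>r=1..n. R r (m r))"
    proof -
      \<comment> \<open>Both sides are \<open>qpoch q (\<alpha> * b * x p) (M + j)\<close>, split
        after \<open>j\<close> and after \<open>m p\<close> factors; \<open>e2\<close> is the same
        with \<open>q\<close> in place of \<open>b\<close>.\<close>
      have e1: "qpoch q (\<alpha> * b * x p) j * qpoch q (\<alpha> * b * d / q) M = qpoch q (\<alpha> * b * x p) (m p) * qpoch q (\<alpha> * b * d' / q) M'"
        using qpoch_add[of q "\<alpha> * b * x p" j M] qpoch_add[of q "\<alpha> * b * x p" "m p" M'] M' q_nonzero
        by (simp add: d_def d'_def add.commute mult_ac)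
      have e2: "qpoch q (\<alpha> * q * x p) j * qpoch q (\<alpha> * d) M = qpoch q (\<alpha> * q * x p) (m p) * qpoch q (\<alpha> * d') M'"
        using qpoch_add[of q "\<alpha> * q * x p" j M] qpoch_add[of q "\<alpha> * q * x p" "m p" M'] M'
        by (simp add: d_def d'_def add.commute mult_ac)
      have nz: "qpoch q (\<alpha> * d) M \<noteq> 0" "qpoch q (\<alpha> * d') M' \<noteq> 0"
         "qpoch q (\<alpha> * b * x p) j \<noteq> 0" "qpoch q (\<alpha> * b * x p) (m p) \<noteq> 0"
        using d_nz b_nz[OF p] less.prems(2)[OF p] by (auto simp: d_def d'_def m'_def simp del: power_Suc)
      have "qpoch q (\<alpha> * b * d' / q) M' / qpoch q (\<alpha> * d') M' * R p j
          = qpoch q (\<alpha> * b * d / q) M / qpoch q (\<alpha> * d) M * R p (m p)"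
        using nz arg_cong2[OF e1 e2 [symmetric], of "\<lambda>u v. u * v"]
        by (simp add: R_def divide_simps mult_ac)
      from arg_cong[OF this, of "\<lambda>u. u * (\<Prod>r\<in>{1..n} - {p}. R r (m r))"] show ?thesis
        unfolding prod.remove[OF finite_atLeastAtMost p] by (simp add: m'_def mult_ac)
    qed
    finally show ?thesis
      using sum_eq[of d] d_nz[of "Suc j" M] by (simp add: d_def C_def divide_simps)
  qed
  have root_c0: "poly P c0 = 0"
  proof -
    \<comment> \<open>The factor with \<alpha> c0 q^(M-1) = 1 lies in this product as soon as the
      size of \<open>k\<close> is below \<open>M\<close>, that is, for every \<open>k\<close> in
      \<open>S\<close> other than \<open>m\<close>.\<close>
    have zero: "qpoch q (\<alpha> * c0 * q ^ mi_size n k) (M - mi_size n k) = 0" if k: "k \<in> S" "k \<noteq> m" for k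
    proof -
      obtain i where "M = Suc (mi_size n k + i)"
        using size_less[OF k] less_imp_Suc_add by blast
      then show ?thesis using assms(1) q_nonzero
        by (auto simp: qpoch_eq_0_iff c0_def power_add intro!: exI[of _ i])
    qed
    have "(\<Sum>k\<in>S. w k * ((\<Prod>r=1..n. qfall q c0 (x r) (k r)) * qpoch q (\<alpha> * c0 * q ^ mi_size n k) (M - mi_size n k)))
       = (\<Sum>k\<in>{m}. w k * ((\<Prod>r=1..n. qfall q c0 (x r) (k r)) * qpoch q (\<alpha> * c0 * q ^ mi_size n k) (M - mi_size n k)))"
      using fin m_in zero by (intro sum.mono_neutral_right) auto
    also have "\<dots> = C * qpoch q (\<alpha> * b * c0 / q) M"
      using top_summand[OF assms(1) gen, where m = m and b = b]
      by (simp add: w_def C_def R_def M_def c0_def)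
    finally show ?thesis by (simp add: poly_P)
  qed
  have "P = 0"
  proof (rule ccontr)
    assume "P \<noteq> 0"
    have inj: "inj_on f A"
    proof (rule inj_onI)
      fix u v assume "u \<in> A" "v \<in> A" "f u = f v"
      then obtain p j p' j' where uv: "u = (p, j)" "v = (p', j')" "p \<in> {1..n}" "p' \<in> {1..n}"
        and eq: "x p * q ^ j = x p' * q ^ j'" using q_nonzero by (auto simp: A_def f_def)
      have "p = p'"
      proof (rule ccontr)
        assume ne: "p \<noteq> p'"
        show False
        proof (cases "j \<le> j'")
          case True
          then have "x p = x p' * q ^ (j' - j)"
            using eq q_nonzero by (simp add: power_diff field_simps)
          then show False using x_generic[of p p'] uv ne by auto
        next
          case False
          then have "x p' = x p * q ^ (j - j')"
            using eq q_nonzero by (simp add: power_diff field_simps)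
          then show False using x_generic[of p' p] uv ne by auto
        qed
      qed
      then show "u = v" using eq uv x_nonzero q_power_inj by auto
    qed
    have "c0 \<notin> f ` A"
    proof
      assume "c0 \<in> f ` A"
      then obtain u where u: "u \<in> A" "c0 = f u" by blast
      obtain p j where "u = (p, j)" by fastforce
      with u have "p \<in> {1..n}" "c0 = x p * q ^ Suc j" by (simp_all add: A_def f_def)
      then show False using gen[of p "j + M"] assms(1) q_nonzero
        by (simp add: c0_def field_simps power_add)
    qed
    moreover have "card A = M" by (simp add: A_def M_def mi_size_def)
    ultimately have "card (insert c0 (f ` A)) = Suc M"
      using inj by (simp add: card_image A_def)
    moreover have "insert c0 (f ` A) \<subseteq> {d. poly P d = 0}"
      using root_f root_c0 by (auto simp: f_def A_def)
    ultimately have "Suc M \<le> card {d. poly P d = 0}"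
      by (metis card_mono poly_roots_finite \<open>P \<noteq> 0\<close>)
    then show False
      using card_poly_roots_bound[OF \<open>P \<noteq> 0\<close>] degree_P by simp
  qed
  then show ?case
    using sum_eq[of c] less.prems(3) by (simp add: B_def C_def R_def M_def)
qed

end

section \<open>The terminating sum for arbitrary \<open>\<alpha>\<close>\<close>

lemma isCont_qpoch [continuous_intros]:
  "isCont f a \<Longrightarrow> isCont (\<lambda>t. qpoch q (f t) k) a"
  unfolding qpoch_def by (intro continuous_intros)

context generic_nodes
begin

text \<open>Near \<open>\<alpha>0\<close> the norm of \<alpha> is bounded, so \<alpha> x_r q^i has
  norm below 1 for all large \<open>i\<close>. Only finitely many values of \<alpha> remain to be
  avoided, and a punctured neighbourhood avoids them.\<close>

lemma eventually_generic:
  "\<forall>\<^sub>F \<alpha> in at \<alpha>0. \<alpha> \<noteq> 0 \<and> (\<forall>r\<in>{1..n}. \<forall>i. \<alpha> * x r * q ^ i \<noteq> 1)"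
proof (intro eventually_conj eventually_ball_finite ballI)
  show "\<forall>\<^sub>F \<alpha> in at \<alpha>0. \<alpha> \<noteq> 0"
    by (rule eventually_neq_at_within)
next
  fix r assume r: "r \<in> {1..n}"
  have "(\<lambda>i. (norm \<alpha>0 + 1) * norm (x r) * norm q ^ i) \<longlonglongrightarrow> (norm \<alpha>0 + 1) * norm (x r) * 0"
    using q_less_1 by (intro tendsto_intros LIMSEQ_power_zero) auto
  then have "\<forall>\<^sub>F i in sequentially. (norm \<alpha>0 + 1) * norm (x r) * norm q ^ i < 1"
    by (rule order_tendstoD) simp
  then obtain N where N: "\<And>i. i \<ge> N \<Longrightarrow> (norm \<alpha>0 + 1) * norm (x r) * norm q ^ i < 1"
    by (auto simp: eventually_sequentially)
  have "\<forall>\<^sub>F \<alpha> in at \<alpha>0. dist \<alpha> \<alpha>0 < 1"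
    by (auto simp: eventually_at intro!: exI[of _ 1])
  moreover have "\<forall>\<^sub>F \<alpha> in at \<alpha>0. \<forall>i\<in>{..<N}. \<alpha> \<noteq> 1 / (x r * q ^ i)"
    by (intro eventually_ball_finite ballI eventually_neq_at_within) auto
  ultimately show "\<forall>\<^sub>F \<alpha> in at \<alpha>0. \<forall>i. \<alpha> * x r * q ^ i \<noteq> 1"
  proof eventually_elim
    case (elim \<alpha>)
    show ?case
    proof (intro allI notI)
      fix i assume eq: "\<alpha> * x r * q ^ i = 1"
      show False
      proof (cases "i < N")
        case True
        then show False using elim(2) eq x_nonzero[OF r] q_nonzero by (auto simp: field_simps)
      next
        case False
        have "norm \<alpha> \<le> norm \<alpha>0 + 1"
          using elim(1) norm_triangle_ineq2[of \<alpha> \<alpha>0] by (simp add: dist_norm)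
        then have "norm (\<alpha> * x r * q ^ i) \<le> (norm \<alpha>0 + 1) * norm (x r) * norm q ^ i"
          by (simp add: norm_mult norm_power mult_right_mono)
        then show False using N[of i] False eq by simp
      qed
    qed
  qed
qed auto

text \<open>Both sides are continuous at \<alpha> and agree at all generic points nearby. On the box
  \<open>k r \<le> m r\<close> each q-product in a denominator that depends on \<alpha> is an
  initial part of one assumed nonzero, which gives continuity of the terms.\<close>

lemma terminating:
  assumes b_nz: "\<And>r. r \<in> {1..n} \<Longrightarrow> qpoch q (\<alpha> * b * x r) (m r) \<noteq> 0"
    and c_nz: "qpoch q (\<alpha> * c) (mi_size n m) \<noteq> 0"
    and x_nz: "\<And>r. r \<in> {1..n} \<Longrightarrow> 1 - \<alpha> * x r \<noteq> 0"
    and y_nz: "\<And>r. r \<in> {1..n} \<Longrightarrow> qpoch q (\<alpha> * (x r * q ^ Suc (m r))) (mi_size n m) \<noteq> 0"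
  shows "(\<Sum>k\<in>(\<Pi>\<^sub>E r\<in>{1..n}. {..m r}). weight q \<alpha> b x n k * (node q \<alpha> x n c k * (\<Prod>s=1..n. node q \<alpha> x n (x s * q ^ Suc (m s)) k)))
    = qpoch q (\<alpha> * b * c / q) (mi_size n m) / qpoch q (\<alpha> * c) (mi_size n m)
      * (\<Prod>r=1..n. qpoch q (\<alpha> * q * x r) (m r) / qpoch q (\<alpha> * b * x r) (m r))"
proof -
  \<comment> \<open>Outside \<open>{1..n}\<close> the function \<open>m\<close> is arbitrary,
    whereas \<open>terminating_generic\<close> expects an extensional one.\<close>
  define m' where "m' = restrict m {1..n}"
  define M where "M = mi_size n m"
  define S where "S = (\<Pi>\<^sub>E r\<in>{1..n}. {..m r})"
  define f where "f = (\<lambda>\<alpha>. \<Sum>k\<in>S. weight q \<alpha> b x n k * (node q \<alpha> x n c k * (\<Prod>s=1..n. node q \<alpha> x n (x s * q ^ Suc (m s)) k)))"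
  define g where "g = (\<lambda>\<alpha>. qpoch q (\<alpha> * b * c / q) M / qpoch q (\<alpha> * c) M
      * (\<Prod>r=1..n. qpoch q (\<alpha> * q * x r) (m r) / qpoch q (\<alpha> * b * x r) (m r)))"
  have fg: "f \<beta> = g \<beta>" if "\<beta> \<noteq> 0" "\<forall>r\<in>{1..n}. \<forall>i. \<beta> * x r * q ^ i \<noteq> 1"
    "\<forall>r\<in>{1..n}. qpoch q (\<beta> * b * x r) (m r) \<noteq> 0" "qpoch q (\<beta> * c) M \<noteq> 0" for \<beta>
  proof -
    have le: "m r \<le> M" if "r \<in> {1..n}" for r
      unfolding M_def mi_size_def using that by (intro member_le_sum) auto
    have M': "mi_size n m' = M" by (simp add: M_def mi_size_def m'_def)
    have "f \<beta> = (\<Sum>k\<in>{1..n} \<rightarrow>\<^sub>E {..M}. weight q \<beta> b x n k * (node q \<beta> x n c k * (\<Prod>s=1..n. node q \<beta> x n (x s * q ^ Suc (m' s)) k)))"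
      unfolding f_def
    proof (rule sum.mono_neutral_cong_left)
      show "S \<subseteq> {1..n} \<rightarrow>\<^sub>E {..M}"
        unfolding S_def using le by (intro PiE_mono) auto
      show "\<forall>k\<in>({1..n} \<rightarrow>\<^sub>E {..M}) - S. weight q \<beta> b x n k * (node q \<beta> x n c k * (\<Prod>s=1..n. node q \<beta> x n (x s * q ^ Suc (m' s)) k)) = 0"
      proof
        fix k assume "k \<in> ({1..n} \<rightarrow>\<^sub>E {..M}) - S"
        then have "\<not> (\<forall>r\<in>{1..n}. k r \<le> m r)" by (auto simp: S_def PiE_iff)
        then obtain r where "r \<in> {1..n}" "m' r < k r" by (auto simp: m'_def not_le)
        then have "(\<Prod>s=1..n. node q \<beta> x n (x s * q ^ Suc (m' s)) k) = 0"
          using node_eq_0[of r n "m' r" k q \<beta> x] by (intro prod_zero) blast+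
        then show "weight q \<beta> b x n k * (node q \<beta> x n c k * (\<Prod>s=1..n. node q \<beta> x n (x s * q ^ Suc (m' s)) k)) = 0"
          by simp
      qed
    qed (auto intro!: finite_PiE simp: m'_def)
    also have "\<dots> = qpoch q (\<beta> * b * c / q) (mi_size n m') / qpoch q (\<beta> * c) (mi_size n m')
      * (\<Prod>r=1..n. qpoch q (\<beta> * q * x r) (m' r) / qpoch q (\<beta> * b * x r) (m' r))"
    proof (rule terminating_generic)
      show "m' \<in> {1..n} \<rightarrow>\<^sub>E {..M}" using le by (simp add: m'_def)
      show "qpoch q (\<beta> * b * x r) (m' r) \<noteq> 0" if "r \<in> {1..n}" for r
        using \<open>\<forall>r\<in>{1..n}. qpoch q (\<beta> * b * x r) (m r) \<noteq> 0\<close> that by (simp add: m'_def)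
    qed (use that M' in auto)
    also have "\<dots> = g \<beta>" unfolding M' g_def by (simp add: m'_def)
    finally show ?thesis .
  qed
  have "isCont f \<alpha>"
    unfolding f_def
  proof (rule continuous_sum)
    fix k assume "k \<in> S"
    then have k: "k r \<le> m r" if "r \<in> {1..n}" for r using that by (auto simp: S_def)
    have K: "mi_size n k \<le> M" unfolding mi_size_def M_def by (intro sum_mono k)
    have "qpoch q (q * x r / x s) j \<noteq> 0" if "r \<in> {1..n}" "s \<in> {1..n}" for r s j
      using that by (rule node_denominator)
    moreover have "qpoch q (\<alpha> * b * x r) (k r) \<noteq> 0" if "r \<in> {1..n}" for r
      using qpoch_nonzero_mono[OF b_nz[OF that] k[OF that]] .
    moreover have "qpoch q (\<alpha> * c) (mi_size n k) \<noteq> 0"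
      using qpoch_nonzero_mono[OF c_nz] K by (simp add: M_def)
    moreover have "qpoch q (\<alpha> * (x r * q ^ Suc (m r))) (mi_size n k) \<noteq> 0" if "r \<in> {1..n}" for r
      using qpoch_nonzero_mono[OF y_nz[OF that]] K by (simp add: M_def)
    ultimately show "isCont (\<lambda>\<alpha>. weight q \<alpha> b x n k * (node q \<alpha> x n c k * (\<Prod>s=1..n. node q \<alpha> x n (x s * q ^ Suc (m s)) k))) \<alpha>"
      unfolding weight_def node_def using x_nz x_nonzero q_nonzero
      by (intro continuous_intros) (auto simp del: power_Suc)
  qed
  moreover have "isCont g \<alpha>"
    unfolding g_def using b_nz c_nz q_nonzero by (intro continuous_intros) (auto simp: M_def)
  moreover have "\<forall>\<^sub>F \<beta> in at \<alpha>. f \<beta> = g \<beta>"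
  proof -
    have "isCont (\<lambda>\<beta>. qpoch q (\<beta> * c) M) \<alpha>" "\<And>r. isCont (\<lambda>\<beta>. qpoch q (\<beta> * b * x r) (m r)) \<alpha>"
      by (intro continuous_intros)+
    then have "\<forall>\<^sub>F \<beta> in at \<alpha>. qpoch q (\<beta> * c) M \<noteq> 0"
      "\<forall>\<^sub>F \<beta> in at \<alpha>. \<forall>r\<in>{1..n}. qpoch q (\<beta> * b * x r) (m r) \<noteq> 0"
      using b_nz c_nz
      by (auto simp: M_def isCont_def intro!: eventually_ball_finite tendsto_imp_eventually_ne)
    then show ?thesis using eventually_generic[of \<alpha>]
      by eventually_elim (auto intro!: fg)
  qed
  ultimately have "f \<midarrow>\<alpha>\<rightarrow> f \<alpha>" "f \<midarrow>\<alpha>\<rightarrow> g \<alpha>"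
    using tendsto_cong[of f g "at \<alpha>" "g \<alpha>"] by (simp_all add: isCont_def)
  then have "f \<alpha> = g \<alpha>"
    by (rule LIM_unique)
  then show ?thesis by (simp add: f_def g_def M_def S_def)
qed

end

section \<open>Infinite q-products and growth of the summands\<close>

lemma qpoch_LIMSEQ:
  assumes "norm q < 1"
  shows "(\<lambda>k. qpoch q z k) \<longlonglongrightarrow> qpoch_inf q z"
    and "convergent_prod (\<lambda>i. 1 - z * q ^ i)"
proof -
  have "summable (\<lambda>i. norm z * norm q ^ i)"
    using assms by (intro summable_mult summable_geometric) simp
  then have "abs_convergent_prod (\<lambda>i. 1 - z * q ^ i)"
    by (simp add: abs_convergent_prod_conv_summable norm_mult norm_power)
  then show *: "convergent_prod (\<lambda>i. 1 - z * q ^ i)"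
    by (rule abs_convergent_prod_imp_convergent_prod)
  show "(\<lambda>k. qpoch q z k) \<longlonglongrightarrow> qpoch_inf q z"
    using convergent_prod_LIMSEQ[OF *] unfolding qpoch_def qpoch_inf_def
    by (subst filterlim_sequentially_Suc [symmetric]) (simp add: lessThan_Suc_atMost)
qed

lemma qpoch_inf_split:
  assumes "norm q < 1"
  shows "qpoch_inf q z = qpoch q z k * qpoch_inf q (z * q ^ k)"
proof (rule LIMSEQ_unique)
  show "(\<lambda>j. qpoch q z (j + k)) \<longlonglongrightarrow> qpoch_inf q z"
    by (rule LIMSEQ_ignore_initial_segment[OF qpoch_LIMSEQ(1)[OF assms]])
  show "(\<lambda>j. qpoch q z (j + k)) \<longlonglongrightarrow> qpoch q z k * qpoch_inf q (z * q ^ k)"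
    unfolding add.commute[of _ k] qpoch_add by (intro tendsto_intros qpoch_LIMSEQ assms)
qed

lemma qpoch_inf_eq_0_iff:
  assumes "norm q < 1"
  shows "qpoch_inf q z = 0 \<longleftrightarrow> (\<exists>i. z * q ^ i = 1)"
proof
  assume "qpoch_inf q z = 0"
  then show "\<exists>i. z * q ^ i = 1"
    using prodinf_nonzero[OF qpoch_LIMSEQ(2)[OF assms], of z] by (auto simp: qpoch_inf_def)
next
  assume "\<exists>i. z * q ^ i = 1"
  then obtain i where "z * q ^ i = 1" by blast
  then show "qpoch_inf q z = 0"
    using qpoch_inf_split[OF assms, of z "Suc i"] by (simp add: qpoch_Suc)
qed

lemma qpoch_inf_nonzero:
  assumes "norm q < 1" "norm z < 1"
  shows "qpoch_inf q z \<noteq> 0"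
proof
  assume "qpoch_inf q z = 0"
  then obtain i where "z * q ^ i = 1" using qpoch_inf_eq_0_iff[OF assms(1)] by blast
  then have "norm z * norm q ^ i = 1" by (metis norm_mult norm_one norm_power)
  moreover have "norm z * norm q ^ i \<le> norm z * 1"
    using assms by (intro mult_left_mono power_le_one) auto
  ultimately show False using assms by simp
qed

lemma qpoch_nonzero: "norm q < 1 \<Longrightarrow> qpoch_inf q z \<noteq> 0 \<Longrightarrow> qpoch q z k \<noteq> 0"
  by (metis qpoch_inf_split mult_zero_left)

text \<open>By 1 + t \<le> exp t the exponents form a geometric sum, so the bound is independent of
  the number of factors.\<close>

lemma norm_prod_le_exp:
  fixes q :: complex and f :: "nat \<Rightarrow> complex"
  assumes q: "norm q < 1" and "0 \<le> R" "\<And>i. norm (f i) \<le> 1 + R * norm q ^ i"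
  shows "norm (\<Prod>i<k. f i) \<le> exp (R / (1 - norm q))"
proof -
  have "norm (\<Prod>i<k. f i) \<le> (\<Prod>i<k. exp (R * norm q ^ i))"
    unfolding prod_norm [symmetric]
    by (intro prod_mono conjI norm_ge_zero order.trans[OF assms(3) exp_ge_add_one_self])
  also have "\<dots> = exp (R * (\<Sum>i<k. norm q ^ i))"
    by (simp add: exp_sum sum_distrib_left)
  also have "\<dots> \<le> exp (R * (1 / (1 - norm q)))"
  proof -
    have "(\<Sum>i<k. norm q ^ i) \<le> (\<Sum>i. norm q ^ i)"
      using q by (intro sum_le_suminf summable_geometric) auto
    also have "\<dots> = 1 / (1 - norm q)" using q by (simp add: suminf_geometric)
    finally show ?thesis unfolding exp_le_cancel_iff using assms(2) by (intro mult_left_mono)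
  qed
  finally show ?thesis by simp
qed

lemma norm_qpoch_le:
  assumes "norm q < 1" "norm z \<le> R"
  shows "norm (qpoch q z k) \<le> exp (R / (1 - norm q))"
  unfolding qpoch_def
proof (rule norm_prod_le_exp)
  fix i
  have "norm (1 - z * q ^ i) \<le> 1 + norm z * norm q ^ i"
    using norm_triangle_ineq4[of 1 "z * q ^ i"] by (simp add: norm_mult norm_power)
  also have "\<dots> \<le> 1 + R * norm q ^ i" using assms by (simp add: mult_right_mono)
  finally show "norm (1 - z * q ^ i) \<le> 1 + R * norm q ^ i" .
qed (use assms norm_ge_zero[of z] in linarith)+

lemma norm_qpoch_inf_le:
  assumes "norm q < 1" "norm z \<le> R"
  shows "norm (qpoch_inf q z) \<le> exp (R / (1 - norm q))"
  using tendsto_norm[OF qpoch_LIMSEQ(1)[OF assms(1)]]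
  by (rule LIMSEQ_le_const2) (use norm_qpoch_le[OF assms] in auto)

text \<open>Dividing each factor by \<open>t\<close> rather than by \<open>u\<close> gives a bound
  uniform on the whole disc, including \<open>u = 0\<close>.\<close>

lemma norm_qfall_le:
  assumes "norm q < 1" "0 < t" "norm u \<le> t"
  shows "norm (qfall q u y k) \<le> t ^ k * exp (norm y / t / (1 - norm q))"
proof -
  have "norm (\<Prod>i<k. (u - y * q ^ Suc i) / of_real t) \<le> exp (norm y / t / (1 - norm q))"
  proof (rule norm_prod_le_exp)
    fix i
    have "norm (u - y * q ^ Suc i) \<le> norm u + norm y * norm q ^ Suc i"
      using norm_triangle_ineq4[of u "y * q ^ Suc i"] by (simp add: norm_mult norm_power)
    also have "\<dots> \<le> t + norm y * norm q ^ i"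
      using assms by (intro add_mono mult_left_mono power_decreasing) auto
    finally show "norm ((u - y * q ^ Suc i) / of_real t) \<le> 1 + norm y / t * norm q ^ i"
      using assms by (simp add: norm_divide divide_simps algebra_simps)
  qed (use assms in auto)
  moreover have "qfall q u y k = of_real t ^ k * (\<Prod>i<k. (u - y * q ^ Suc i) / of_real t)"
    using assms by (simp add: qfall_def prod_dividef)
  ultimately show ?thesis
    using assms by (simp only: norm_mult norm_power norm_of_real) (simp add: mult_left_mono)
qed

section \<open>Holomorphy of the q-products\<close>

lemma holomorphic_qpoch [holomorphic_intros]:
  "f holomorphic_on A \<Longrightarrow> (\<lambda>z. qpoch q (f z) k) holomorphic_on A"
  unfolding qpoch_def by (intro holomorphic_intros)

lemma holomorphic_qfall [holomorphic_intros]: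
  "f holomorphic_on A \<Longrightarrow> (\<lambda>z. qfall q (f z) y k) holomorphic_on A"
  unfolding qfall_def by (intro holomorphic_intros)

text \<open>The finite products are polynomials in \<open>z\<close>, and on a unit disc around
  \<open>z0\<close> the deviations of their factors from 1 are dominated by a geometric series,
  whence locally uniform convergence.\<close>

lemma holomorphic_qpoch_inf:
  assumes "norm q < 1"
  shows "qpoch_inf q holomorphic_on UNIV"
proof (rule holomorphic_uniform_sequence[where f = "\<lambda>k z. qpoch q z k"])
  fix z0 :: complex
  let ?A = "cball z0 1"
  have "uniformly_convergent_on ?A (\<lambda>N z. \<Sum>i<N. norm ((1 - z * q ^ i) - 1))"
  proof (rule Weierstrass_m_test'_ev[OF always_eventually])
    show "summable (\<lambda>i. (norm z0 + 1) * norm q ^ i)"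
      using assms by (intro summable_mult summable_geometric) simp
    show "\<forall>i. \<forall>z\<in>?A. norm (norm ((1 - z * q ^ i) - 1)) \<le> (norm z0 + 1) * norm q ^ i"
    proof (intro allI ballI)
      fix i and z :: complex assume "z \<in> ?A"
      then have "norm z \<le> norm z0 + 1"
        using norm_triangle_ineq2[of z z0] by (simp add: dist_norm norm_minus_commute)
      then show "norm (norm ((1 - z * q ^ i) - 1)) \<le> (norm z0 + 1) * norm q ^ i"
        by (simp add: norm_mult norm_power mult_right_mono)
    qed
  qed
  then have "uniformly_convergent_on ?A (\<lambda>N z. \<Prod>i<N. 1 - z * q ^ i)"
    by (intro uniformly_convergent_on_prod' continuous_intros) auto
  then have "uniform_limit ?A (\<lambda>k z. qpoch q z k) (\<lambda>z. lim (\<lambda>k. qpoch q z k)) sequentially"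
    unfolding qpoch_def by (simp add: uniformly_convergent_uniform_limit_iff)
  then have "uniform_limit ?A (\<lambda>k z. qpoch q z k) (qpoch_inf q) sequentially"
    using limI[OF qpoch_LIMSEQ(1)[OF assms]] by simp
  then show "\<exists>d>0. cball z0 d \<subseteq> UNIV \<and> uniform_limit (cball z0 d) (\<lambda>k z. qpoch q z k) (qpoch_inf q) sequentially"
    by (intro exI[of _ 1]) simp
qed (auto intro!: holomorphic_intros)

lemma holomorphic_qpoch_inf_comp [holomorphic_intros]:
  assumes "norm q < 1" "f holomorphic_on A"
  shows "(\<lambda>z. qpoch_inf q (f z)) holomorphic_on A"
  using holomorphic_on_compose[OF assms(2) holomorphic_on_subset[OF holomorphic_qpoch_inf[OF assms(1)]]]
  by (simp add: o_def)

text \<open>A finite set of multi-indices lies in a box, over which the sum factors into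
  \<open>n\<close> partial geometric sums.\<close>

lemma summable_power_mi_size:
  assumes "0 \<le> t" "t < (1::real)"
  shows "(\<lambda>k. t ^ mi_size n k) summable_on multi_indices n"
proof (rule nonneg_bdd_above_summable_on)
  show "bdd_above (sum (\<lambda>k. t ^ mi_size n k) ` {F. F \<subseteq> multi_indices n \<and> finite F})"
  proof (rule bdd_aboveI2)
    fix F assume F: "F \<in> {F. F \<subseteq> multi_indices n \<and> finite F}"
    \<comment> \<open>A crude bound: the total of all sizes dominates every component of every
      member of \<open>F\<close>.\<close>
    define L where "L = Suc (\<Sum>k\<in>F. mi_size n k)"
    have sub: "F \<subseteq> {1..n} \<rightarrow>\<^sub>E {..<L}"
    proof
      fix k assume k: "k \<in> F"
      have "k r < L" if "r \<in> {1..n}" for r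
      proof -
        have "k r \<le> mi_size n k" unfolding mi_size_def using that by (intro member_le_sum) auto
        also have "\<dots> \<le> (\<Sum>k\<in>F. mi_size n k)" using k F by (intro member_le_sum) auto
        finally show ?thesis by (simp add: L_def)
      qed
      then show "k \<in> {1..n} \<rightarrow>\<^sub>E {..<L}" using k F by (auto simp: multi_indices_def PiE_iff)
    qed
    have "(\<Sum>k\<in>F. t ^ mi_size n k) \<le> (\<Sum>k\<in>{1..n} \<rightarrow>\<^sub>E {..<L}. t ^ mi_size n k)"
      using sub assms by (intro sum_mono2) (auto intro!: finite_PiE)
    also have "\<dots> = (\<Prod>r=1..n. \<Sum>i<L. t ^ i)"
      by (subst prod_sum_PiE) (auto simp: mi_size_def power_sum)
    also have "\<dots> \<le> (\<Prod>r=1..n. 1 / (1 - t))"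
    proof (intro prod_mono conjI)
      have "(\<Sum>i<L. t ^ i) \<le> (\<Sum>i. t ^ i)"
        using assms by (intro sum_le_suminf summable_geometric) auto
      then show "(\<Sum>i<L. t ^ i) \<le> 1 / (1 - t)" using assms by (simp add: suminf_geometric)
    qed (use assms in \<open>auto intro!: sum_nonneg\<close>)
    finally show "(\<Sum>k\<in>F. t ^ mi_size n k) \<le> (\<Prod>r=1..n. 1 / (1 - t))" .
  qed
qed (use assms in auto)

section \<open>Bounded families and geometric growth\<close>

definition bounded_family :: "('a \<Rightarrow> complex) \<Rightarrow> bool" where
  "bounded_family f \<longleftrightarrow> (\<exists>C. \<forall>k. norm (f k) \<le> C)"

lemma bounded_familyI: "(\<And>k. norm (f k) \<le> C) \<Longrightarrow> bounded_family f"
  by (auto simp: bounded_family_def)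

lemma bounded_family_const: "bounded_family (\<lambda>_. c)"
  by (rule bounded_familyI[of _ "norm c"]) simp

lemma bounded_family_mult:
  assumes "bounded_family f" "bounded_family g"
  shows "bounded_family (\<lambda>k. f k * g k)"
proof -
  obtain C D where C: "\<And>k. norm (f k) \<le> C" and D: "\<And>k. norm (g k) \<le> D"
    using assms by (auto simp: bounded_family_def)
  have "norm (f k * g k) \<le> C * D" for k
    unfolding norm_mult by (intro mult_mono C D norm_ge_zero order.trans[OF norm_ge_zero C])
  then show ?thesis by (rule bounded_familyI)
qed

lemma bounded_family_prod:
  assumes "\<And>i. i \<in> I \<Longrightarrow> bounded_family (f i)"
  shows "bounded_family (\<lambda>k. \<Prod>i\<in>I. f i k)"
  using assms
  by (induction I rule: infinite_finite_induct)
     (simp_all add: bounded_family_const bounded_family_mult)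

lemma bounded_family_qpoch: "norm q < 1 \<Longrightarrow> bounded_family (\<lambda>k. qpoch q z (h k))"
  by (rule bounded_familyI[OF norm_qpoch_le[OF _ order.refl]])

text \<open>No factor vanishes, so the finite products tend to a nonzero limit and their reciprocals
  converge.\<close>

lemma bounded_family_inverse_qpoch:
  assumes "norm q < 1" "\<And>k. qpoch q z k \<noteq> 0"
  shows "bounded_family (\<lambda>k. 1 / qpoch q z (h k))"
proof -
  have "z * q ^ i \<noteq> 1" for i
    using assms(2)[of "Suc i"] by (auto simp: qpoch_Suc)
  then have "qpoch_inf q z \<noteq> 0"
    using qpoch_inf_eq_0_iff[OF assms(1)] by blast
  then have "(\<lambda>k. inverse (qpoch q z k)) \<longlonglongrightarrow> inverse (qpoch_inf q z)"
    by (intro tendsto_inverse qpoch_LIMSEQ assms)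
  then have "Bseq (\<lambda>k. inverse (qpoch q z k))"
    by (intro convergent_imp_Bseq convergentI)
  then obtain C where "\<And>k. norm (inverse (qpoch q z k)) \<le> C"
    unfolding Bseq_def by blast
  then show ?thesis by (intro bounded_familyI[of _ C]) (simp add: inverse_eq_divide)
qed

text \<open>An exact factorisation with a complex ratio, not an estimate: ratios then simply
  multiply, and for the whole summand they give the argument of the series.\<close>

definition geometric_growth :: "nat \<Rightarrow> complex \<Rightarrow> ((nat \<Rightarrow> nat) \<Rightarrow> complex) \<Rightarrow> bool" where
  "geometric_growth n z f \<longleftrightarrow> (\<exists>g. bounded_family g \<and> (\<forall>k. f k = g k * z ^ mi_size n k))"

lemma geometric_growthI:
  "bounded_family g \<Longrightarrow> (\<And>k. f k = g k * z ^ mi_size n k) \<Longrightarrow> geometric_growth n z f"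
  by (auto simp: geometric_growth_def)

lemma geometric_growth_mult:
  assumes "geometric_growth n z f" "geometric_growth n w g"
  shows "geometric_growth n (z * w) (\<lambda>k. f k * g k)"
proof -
  obtain f' g' where "bounded_family f'" "bounded_family g'"
    "\<And>k. f k = f' k * z ^ mi_size n k" "\<And>k. g k = g' k * w ^ mi_size n k"
    using assms unfolding geometric_growth_def by blast
  then show ?thesis
    by (intro geometric_growthI[of "\<lambda>k. f' k * g' k"] bounded_family_mult)
       (simp_all add: power_mult_distrib)
qed

lemma geometric_growth_prod:
  assumes "\<And>i. i \<in> I \<Longrightarrow> geometric_growth n (z i) (f i)"
  shows "geometric_growth n (\<Prod>i\<in>I. z i) (\<lambda>k. \<Prod>i\<in>I. f i k)"
proof -
  have "geometric_growth n 1 (\<lambda>k. 1)"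
    by (rule geometric_growthI[of "\<lambda>_. 1"]) (simp_all add: bounded_family_const)
  then show ?thesis
    using assms
    by (induction I rule: infinite_finite_induct) (simp_all add: geometric_growth_mult)
qed

context generic_nodes
begin

lemma weight_growth:
  assumes "b \<noteq> 0" "\<And>r k. r \<in> {1..n} \<Longrightarrow> qpoch q (\<alpha> * b * x r) k \<noteq> 0"
  shows "geometric_growth n (\<alpha> * b / (q ^ (1 + n) * (\<Prod>r=1..n. x r))) (weight q \<alpha> b x n)"
proof -
  define f where "f = (\<lambda>k. (\<Prod>r=1..n. \<Prod>s\<in>{r<..n}. (x s * q ^ k s - x r * q ^ k r) / (x s - x r))
     * (\<Prod>r=1..n. \<Prod>s=1..n. 1 / qpoch q (q * x r / x s) (k r))
     * (\<Prod>r=1..n. (1 - \<alpha> * x r * q ^ (k r + mi_size n k)) * qpoch q (\<alpha> * x r) (mi_size n k) * (1 / (1 - \<alpha> * x r)))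
     * qpoch q (q / b) (mi_size n k) * (\<Prod>r=1..n. 1 / qpoch q (\<alpha> * b * x r) (k r)))"
  have q1: "norm q ^ i \<le> 1" for i using q_less_1 by (simp add: power_le_one)
  have "bounded_family (\<lambda>k :: nat \<Rightarrow> nat. (x s * q ^ k s - x r * q ^ k r) / (x s - x r))" for r s
  proof (rule bounded_familyI)
    fix k :: "nat \<Rightarrow> nat"
    have "norm (x s * q ^ k s - x r * q ^ k r) \<le> norm (x s * q ^ k s) + norm (x r * q ^ k r)"
      by (rule norm_triangle_ineq4)
    also have "\<dots> \<le> norm (x s) * 1 + norm (x r) * 1"
      unfolding norm_mult norm_power by (intro add_mono mult_left_mono q1) auto
    finally show "norm ((x s * q ^ k s - x r * q ^ k r) / (x s - x r)) \<le> (norm (x s) + norm (x r)) / norm (x s - x r)"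
      by (simp add: norm_divide divide_right_mono)
  qed
  moreover have "bounded_family (\<lambda>k :: nat \<Rightarrow> nat. 1 - \<alpha> * x r * q ^ (k r + mi_size n k))" for r
  proof (rule bounded_familyI)
    fix k :: "nat \<Rightarrow> nat"
    have "norm (1 - \<alpha> * x r * q ^ (k r + mi_size n k)) \<le> 1 + norm (\<alpha> * x r) * norm q ^ (k r + mi_size n k)"
      using norm_triangle_ineq4[of 1 "\<alpha> * x r * q ^ (k r + mi_size n k)"] by (simp add: norm_mult norm_power)
    also have "\<dots> \<le> 1 + norm (\<alpha> * x r) * 1"
      by (intro add_left_mono mult_left_mono q1) auto
    finally show "norm (1 - \<alpha> * x r * q ^ (k r + mi_size n k)) \<le> 1 + norm (\<alpha> * x r) * 1" .
  qed
  ultimately have "bounded_family f"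
    unfolding f_def
    by (intro bounded_family_mult bounded_family_prod bounded_family_qpoch bounded_family_const
         bounded_family_inverse_qpoch q_less_1 node_denominator assms(2)) auto
  moreover have "weight q \<alpha> b x n k = f k * (\<alpha> * b / (q ^ (1 + n) * (\<Prod>r=1..n. x r))) ^ mi_size n k" for k
    using assms(1) unfolding weight_def f_def vand_def
    by (simp add: qfall_eq_qpoch prod_dividef power_mult_distrib power_divide mult_ac)
  ultimately show ?thesis by (rule geometric_growthI)
qed

lemma node_growth:
  assumes "y \<noteq> 0" "\<And>k. qpoch q (\<alpha> * y) k \<noteq> 0"
  shows "geometric_growth n y (node q \<alpha> x n y)"
proof -
  define f where "f = (\<lambda>k. (\<Prod>r=1..n. qpoch q (q * x r / y) (k r)) * (1 / qpoch q (\<alpha> * y) (mi_size n k)))"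
  have "bounded_family f"
    unfolding f_def
    by (intro bounded_family_mult bounded_family_prod bounded_family_qpoch
         bounded_family_inverse_qpoch q_less_1 assms(2))
  moreover have "node q \<alpha> x n y k = f k * y ^ mi_size n k" for k
    using assms(1) by (simp add: node_def f_def qfall_eq_qpoch prod.distrib mi_size_def power_sum)
  ultimately show ?thesis by (rule geometric_growthI)
qed

text \<open>The quantity bounded is \<open>node\<close> times
  \<open>qpoch_inf q (\<alpha> * w)\<close>, which has no poles in \<open>w\<close>. Uniformity over
  the disc is what the Weierstrass test requires.\<close>

lemma node_numerator_bound:
  assumes "0 < \<rho>"
  obtains C where "0 \<le> C" "\<And>w k. norm w \<le> \<rho> \<Longrightarrow>
    norm ((\<Prod>r=1..n. qfall q w (x r) (k r)) * qpoch_inf q (\<alpha> * w * q ^ mi_size n k)) \<le> C * \<rho> ^ mi_size n k"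
proof -
  define C where "C = (\<Prod>r=1..n. exp (norm (x r) / \<rho> / (1 - norm q))) * exp (norm \<alpha> * \<rho> / (1 - norm q))"
  show ?thesis
  proof
    show "0 \<le> C" by (simp add: C_def prod_nonneg)
    fix w :: complex and k assume w: "norm w \<le> \<rho>"
    have "norm (\<alpha> * w * q ^ mi_size n k) \<le> norm \<alpha> * norm w * 1"
      unfolding norm_mult norm_power using q_less_1 by (intro mult_left_mono power_le_one) auto
    also have "\<dots> \<le> norm \<alpha> * \<rho>" using w by (simp add: mult_left_mono)
    finally have "norm (qpoch_inf q (\<alpha> * w * q ^ mi_size n k)) \<le> exp (norm \<alpha> * \<rho> / (1 - norm q))"
      by (intro norm_qpoch_inf_le q_less_1)
    moreover have "norm (\<Prod>r=1..n. qfall q w (x r) (k r)) \<le> (\<Prod>r=1..n. \<rho> ^ k r * exp (norm (x r) / \<rho> / (1 - norm q)))"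
      unfolding prod_norm [symmetric]
      by (intro prod_mono conjI norm_ge_zero norm_qfall_le q_less_1 assms w)
    ultimately have "norm ((\<Prod>r=1..n. qfall q w (x r) (k r)) * qpoch_inf q (\<alpha> * w * q ^ mi_size n k))
       \<le> (\<Prod>r=1..n. \<rho> ^ k r * exp (norm (x r) / \<rho> / (1 - norm q))) * exp (norm \<alpha> * \<rho> / (1 - norm q))"
      unfolding norm_mult using assms by (intro mult_mono) (auto intro!: prod_nonneg)
    also have "\<dots> = C * \<rho> ^ mi_size n k"
      by (simp add: C_def prod.distrib mi_size_def power_sum)
    finally show "norm ((\<Prod>r=1..n. qfall q w (x r) (k r)) * qpoch_inf q (\<alpha> * w * q ^ mi_size n k)) \<le> C * \<rho> ^ mi_size n k" .
  qed
qed

end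

section \<open>Analytic continuation\<close>

context generic_nodes
begin

definition summand :: "complex \<Rightarrow> complex \<Rightarrow> complex \<Rightarrow> (nat \<Rightarrow> complex) \<Rightarrow> (nat \<Rightarrow> nat) \<Rightarrow> complex" where
  "summand \<alpha> b c y k = weight q \<alpha> b x n k * (node q \<alpha> x n c k * (\<Prod>s=1..n. node q \<alpha> x n (y s) k))"

text \<open>The product side in terms of \<open>y r = x r * a r\<close>; the product of the
  \<open>a r\<close> thus becomes a quotient of products of \<open>y r\<close> and
  \<open>x r\<close>.\<close>

definition closed_form :: "complex \<Rightarrow> complex \<Rightarrow> complex \<Rightarrow> (nat \<Rightarrow> complex) \<Rightarrow> complex" where
  "closed_form \<alpha> b c y =
     qpoch_inf q (\<alpha> * b * c / q) * qpoch_inf q (\<alpha> * c * (\<Prod>r=1..n. y r) / (q ^ n * (\<Prod>r=1..n. x r)))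
     / (qpoch_inf q (\<alpha> * c) * qpoch_inf q (\<alpha> * b * c * (\<Prod>r=1..n. y r) / (q ^ (1 + n) * (\<Prod>r=1..n. x r))))
     * (\<Prod>r=1..n. (qpoch_inf q (\<alpha> * q * x r) * qpoch_inf q (\<alpha> * b * y r / q))
                 / (qpoch_inf q (\<alpha> * b * x r) * qpoch_inf q (\<alpha> * y r)))"

text \<open>Splitting off finitely many factors with \<open>qpoch_inf_split\<close> turns every
  quotient of infinite products into the finite one of \<open>terminating\<close>; the terms outside
  the box vanish by \<open>node_eq_0\<close>.\<close>

lemma terminating_has_sum:
  assumes y: "\<And>s. s \<in> {1..n} \<Longrightarrow> y s = x s * q ^ Suc (m s)"
    and x_nz: "\<And>r. r \<in> {1..n} \<Longrightarrow> 1 - \<alpha> * x r \<noteq> 0"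
    and b_nz: "\<And>r. r \<in> {1..n} \<Longrightarrow> qpoch_inf q (\<alpha> * b * x r) \<noteq> 0"
    and y_nz: "\<And>r. r \<in> {1..n} \<Longrightarrow> qpoch_inf q (\<alpha> * y r) \<noteq> 0"
    and c_nz: "qpoch_inf q (\<alpha> * c) \<noteq> 0"
    and z_nz: "qpoch_inf q (\<alpha> * b * c * (\<Prod>r=1..n. y r) / (q ^ (1 + n) * (\<Prod>r=1..n. x r))) \<noteq> 0"
  shows "(summand \<alpha> b c y has_sum closed_form \<alpha> b c y) (multi_indices n)"
proof -
  define M where "M = mi_size n m"
  define X where "X = (\<Prod>r=1..n. x r)"
  have X0: "X \<noteq> 0" using x_nonzero by (simp add: X_def)
  have Y: "(\<Prod>r=1..n. y r) = X * q ^ M * q ^ n"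
    using y by (simp add: prod.distrib X_def M_def mi_size_def power_sum)
  have summand: "summand \<alpha> b c y k = weight q \<alpha> b x n k * (node q \<alpha> x n c k * (\<Prod>s=1..n. node q \<alpha> x n (x s * q ^ Suc (m s)) k))" for k
    unfolding summand_def using y by (intro arg_cong2[of _ _ _ _ "(*)"] prod.cong refl) auto
  have args: "\<alpha> * c * (\<Prod>r=1..n. y r) / (q ^ n * X) = \<alpha> * c * q ^ M"
     "\<alpha> * b * c * (\<Prod>r=1..n. y r) / (q ^ (1 + n) * X) = \<alpha> * b * c / q * q ^ M"
    using X0 q_nonzero unfolding Y by simp_all
  have c_nz': "qpoch_inf q (\<alpha> * c * q ^ M) \<noteq> 0"
    using c_nz qpoch_inf_split[OF q_less_1, of "\<alpha> * c" M] by auto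
  have z_nz': "qpoch_inf q (\<alpha> * b * c / q * q ^ M) \<noteq> 0"
    using z_nz unfolding X_def [symmetric] args .
  have factor: "qpoch_inf q (\<alpha> * q * x r) * qpoch_inf q (\<alpha> * b * y r / q) / (qpoch_inf q (\<alpha> * b * x r) * qpoch_inf q (\<alpha> * y r))
     = qpoch q (\<alpha> * q * x r) (m r) / qpoch q (\<alpha> * b * x r) (m r)" if r: "r \<in> {1..n}" for r
  proof -
    have "qpoch_inf q (\<alpha> * q * x r) = qpoch q (\<alpha> * q * x r) (m r) * qpoch_inf q (\<alpha> * y r)"
      using qpoch_inf_split[OF q_less_1, of "\<alpha> * q * x r" "m r"] y[OF r] by (simp add: mult_ac)
    moreover have b: "qpoch_inf q (\<alpha> * b * x r) = qpoch q (\<alpha> * b * x r) (m r) * qpoch_inf q (\<alpha> * b * y r / q)"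
      using qpoch_inf_split[OF q_less_1, of "\<alpha> * b * x r" "m r"] y[OF r] q_nonzero by (simp add: mult_ac)
    moreover have "qpoch_inf q (\<alpha> * b * y r / q) \<noteq> 0" using b_nz[OF r] b by auto
    ultimately show ?thesis using y_nz[OF r] by simp
  qed
  have "closed_form \<alpha> b c y = qpoch q (\<alpha> * b * c / q) M / qpoch q (\<alpha> * c) M
     * (\<Prod>r=1..n. qpoch q (\<alpha> * q * x r) (m r) / qpoch q (\<alpha> * b * x r) (m r))"
    unfolding closed_form_def X_def [symmetric] args
    using c_nz' z_nz' factor qpoch_inf_split[OF q_less_1, of "\<alpha> * c" M] qpoch_inf_split[OF q_less_1, of "\<alpha> * b * c / q" M]
    by simp
  also have "\<dots> = (\<Sum>k\<in>(\<Pi>\<^sub>E r\<in>{1..n}. {..m r}). summand \<alpha> b c y k)"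
    unfolding summand M_def
    using b_nz c_nz y_nz x_nz y by (intro terminating [symmetric] qpoch_nonzero q_less_1) auto
  finally show ?thesis
  proof (rule has_sum_finite_neutralI[rotated 3])
    fix k assume k: "k \<in> multi_indices n - (\<Pi>\<^sub>E r\<in>{1..n}. {..m r})"
    then have "\<not> (\<forall>r\<in>{1..n}. k r \<le> m r)" by (auto simp: multi_indices_def PiE_iff)
    then obtain r where "r \<in> {1..n}" "m r < k r" by (meson not_le)
    then have "(\<Prod>s=1..n. node q \<alpha> x n (x s * q ^ Suc (m s)) k) = 0"
      using node_eq_0[of r n "m r" k q \<alpha> x] by (intro prod_zero) blast+
    then show "summand \<alpha> b c y k = 0" by (simp add: summand)
  qed (auto intro!: finite_PiE simp: multi_indices_def PiE_iff)
qed

text \<open>\<open>J\<close> holds the indices whose parameter has been freed from the special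
  values. The empty set is the terminating case, and each induction step frees one more index
  \<open>p\<close> by the identity theorem.\<close>

lemma nonterminating_has_sum:
  assumes "b \<noteq> 0" "c \<noteq> 0"
    and x_nz: "\<And>r. r \<in> {1..n} \<Longrightarrow> 1 - \<alpha> * x r \<noteq> 0"
    and b_nz: "\<And>r. r \<in> {1..n} \<Longrightarrow> qpoch_inf q (\<alpha> * b * x r) \<noteq> 0"
    and c_nz: "qpoch_inf q (\<alpha> * c) \<noteq> 0"
    and "finite J" "J \<subseteq> {1..n}"
    and "\<And>s. s \<in> {1..n} - J \<Longrightarrow> \<exists>m. y s = x s * q ^ Suc m"
    and "\<And>s. s \<in> {1..n} \<Longrightarrow> y s \<noteq> 0"
    and "\<And>s. s \<in> {1..n} \<Longrightarrow> qpoch_inf q (\<alpha> * y s) \<noteq> 0"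
    and "norm (\<alpha> * b * c * (\<Prod>r=1..n. y r) / (q ^ (1 + n) * (\<Prod>r=1..n. x r))) < 1"
  shows "(summand \<alpha> b c y has_sum closed_form \<alpha> b c y) (multi_indices n)"
  using assms(6-)
proof (induction J arbitrary: y rule: finite_induct)
  case empty
  then obtain m where m: "\<And>s. s \<in> {1..n} \<Longrightarrow> y s = x s * q ^ Suc (m s)"
    by (metis Diff_empty)
  show ?case
    by (rule terminating_has_sum[OF m x_nz b_nz empty.prems(4) c_nz qpoch_inf_nonzero[OF q_less_1 empty.prems(5)]])
next
  case (insert p J)
  have p: "p \<in> {1..n}" using insert.prems(1) by simp
  define I where "I = {1..n} - {p}"
  define X where "X = (\<Prod>r=1..n. x r)"
  define Y where "Y = (\<Prod>r\<in>I. y r)"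
  define Z where "Z = \<alpha> * b * c * Y / (q ^ (1 + n) * X)"
  have prod_p: "(\<Prod>r=1..n. g r) = g p * (\<Prod>r\<in>I. g r)" for g :: "nat \<Rightarrow> complex"
    unfolding I_def using p by (simp add: prod.remove)
  have prod_I: "(\<Prod>r\<in>I. g ((y(p := w)) r) r) = (\<Prod>r\<in>I. g (y r) r)" for g :: "complex \<Rightarrow> nat \<Rightarrow> complex" and w
    unfolding I_def by (intro prod.cong) auto
  have z: "\<alpha> * b * c * (\<Prod>r=1..n. (y(p := w)) r) / (q ^ (1 + n) * X) = Z * w" for w
    unfolding prod_p prod_I[of "\<lambda>u _. u"] Z_def Y_def by simp
  have Zy: "norm Z * norm (y p) < 1"
    using insert.prems(5) z[of "y p"] by (simp add: X_def norm_mult)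
  \<comment> \<open>The disc of radius \<open>\<rho>\<close> must contain \<open>y p\<close> while
    the series still converges uniformly on it. For the \<open>\<epsilon>\<close> below, norm Z *
    (norm (y p) + \<open>\<epsilon>\<close>) equals 1 - \<open>\<epsilon>\<close>.\<close>
  obtain \<rho> where \<rho>: "norm (y p) < \<rho>" "norm Z * \<rho> < 1"
  proof -
    define \<epsilon> where "\<epsilon> = (1 - norm Z * norm (y p)) / (norm Z + 1)"
    have "0 < norm Z + 1" using norm_ge_zero[of Z] by linarith
    then have "0 < \<epsilon>" "(norm Z + 1) * \<epsilon> = 1 - norm Z * norm (y p)"
      using Zy by (simp_all add: \<epsilon>_def)
    then show ?thesis by (intro that[of "norm (y p) + \<epsilon>"]) (simp_all add: algebra_simps)
  qed
  have \<rho>0: "0 < \<rho>" using \<rho> norm_ge_zero[of "y p"] by linarith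
  \<comment> \<open>Both sides, with \<open>w\<close> in place of \<open>y p\<close>, are multiplied
    by \<open>qpoch_inf q (\<alpha> * w)\<close> to remove the poles of the node. The left side
    becomes \<open>f\<close> with \<open>coeff\<close> free of \<open>w\<close>, the right side
    becomes \<open>h\<close>.\<close>
  define coeff where "coeff = (\<lambda>k. weight q \<alpha> b x n k * (node q \<alpha> x n c k * (\<Prod>s\<in>I. node q \<alpha> x n (y s) k)))"
  define num where "num = (\<lambda>w k. (\<Prod>r=1..n. qfall q w (x r) (k r)) * qpoch_inf q (\<alpha> * w * q ^ mi_size n k))"
  define f where "f = (\<lambda>w. \<Sum>\<^sub>\<infinity>k\<in>multi_indices n. coeff k * num w k)"
  define h where "h = (\<lambda>w. qpoch_inf q (\<alpha> * b * c / q) * qpoch_inf q (\<alpha> * c * Y * w / (q ^ n * X))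
     / (qpoch_inf q (\<alpha> * c) * qpoch_inf q (Z * w))
     * (qpoch_inf q (\<alpha> * q * x p) * qpoch_inf q (\<alpha> * b * w / q) / qpoch_inf q (\<alpha> * b * x p))
     * (\<Prod>r\<in>I. (qpoch_inf q (\<alpha> * q * x r) * qpoch_inf q (\<alpha> * b * y r / q))
                 / (qpoch_inf q (\<alpha> * b * x r) * qpoch_inf q (\<alpha> * y r))))"
  have summand_eq: "summand \<alpha> b c (y(p := w)) k * qpoch_inf q (\<alpha> * w) = coeff k * num w k"
    if "qpoch_inf q (\<alpha> * w) \<noteq> 0" for w k
  proof -
    have "node q \<alpha> x n w k * qpoch_inf q (\<alpha> * w) = num w k"
      using qpoch_nonzero[OF q_less_1 that] unfolding node_def num_def
      by (subst qpoch_inf_split[OF q_less_1, of _ "mi_size n k"]) simp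
    moreover have "summand \<alpha> b c (y(p := w)) k = coeff k * node q \<alpha> x n w k"
      unfolding summand_def coeff_def prod_p prod_I[of "\<lambda>u _. node q \<alpha> x n u k"] by simp
    ultimately show ?thesis by (simp add: mult.assoc)
  qed
  have closed_form_eq: "closed_form \<alpha> b c (y(p := w)) * qpoch_inf q (\<alpha> * w) = h w"
    if "qpoch_inf q (\<alpha> * w) \<noteq> 0" for w
  proof -
    have 1: "\<alpha> * c * (\<Prod>r=1..n. (y(p := w)) r) / (q ^ n * X) = \<alpha> * c * Y * w / (q ^ n * X)"
      unfolding prod_p prod_I[of "\<lambda>u _. u"] Y_def by simp
    show ?thesis
      unfolding closed_form_def h_def X_def [symmetric] 1 z
      unfolding prod_p prod_I[of "\<lambda>u r. (qpoch_inf q (\<alpha> * q * x r) * qpoch_inf q (\<alpha> * b * u / q))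
                 / (qpoch_inf q (\<alpha> * b * x r) * qpoch_inf q (\<alpha> * u))"]
      using that by (simp add: mult_ac)
  qed
  have "geometric_growth n (\<alpha> * b / (q ^ (1 + n) * X) * (c * Y)) coeff"
    unfolding coeff_def X_def Y_def using insert.prems b_nz c_nz assms(1,2)
    by (intro geometric_growth_mult geometric_growth_prod weight_growth node_growth qpoch_nonzero q_less_1)
       (auto simp: I_def)
  moreover have "\<alpha> * b / (q ^ (1 + n) * X) * (c * Y) = Z" by (simp add: Z_def)
  ultimately obtain g where "bounded_family g" and g: "\<And>k. coeff k = g k * Z ^ mi_size n k"
    unfolding geometric_growth_def by auto
  then obtain C1 where C1: "\<And>k. norm (g k) \<le> C1" by (auto simp: bounded_family_def)
  obtain C2 where C2: "0 \<le> C2" "\<And>w k. norm w \<le> \<rho> \<Longrightarrow> norm (num w k) \<le> C2 * \<rho> ^ mi_size n k"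
    unfolding num_def using node_numerator_bound[OF \<rho>0] by metis
  have bound: "norm (coeff k * num w k) \<le> C1 * C2 * (norm Z * \<rho>) ^ mi_size n k" if "norm w \<le> \<rho>" for w k
  proof -
    have "norm (coeff k * num w k) \<le> (C1 * norm Z ^ mi_size n k) * (C2 * \<rho> ^ mi_size n k)"
      unfolding norm_mult[of "coeff k"]
    proof (rule mult_mono)
      show "norm (coeff k) \<le> C1 * norm Z ^ mi_size n k"
        unfolding g norm_mult norm_power by (intro mult_right_mono C1) auto
      show "0 \<le> C1 * norm Z ^ mi_size n k"
        using order.trans[OF norm_ge_zero C1] by simp
    qed (use C2 that in auto)
    then show ?thesis by (simp add: power_mult_distrib mult_ac)
  qed
  have bound_summable: "(\<lambda>k. C1 * C2 * (norm Z * \<rho>) ^ mi_size n k) summable_on multi_indices n"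
    using \<rho> \<rho>0 by (intro summable_on_cmult_right summable_power_mi_size) auto
  have f_has_sum: "((\<lambda>k. coeff k * num w k) has_sum f w) (multi_indices n)" if "norm w \<le> \<rho>" for w
    unfolding f_def
  proof (rule has_sum_infsum, rule abs_summable_summable, rule summable_on_comparison_test[OF bound_summable])
  qed (use bound that in auto)
  have f_holo: "f holomorphic_on ball 0 \<rho>"
  proof (rule holomorphic_uniform_limit)
    show "uniform_limit (cball 0 \<rho>) (\<lambda>F w. \<Sum>k\<in>F. coeff k * num w k) f (finite_subsets_at_top (multi_indices n))"
      unfolding f_def using bound bound_summable by (intro Weierstrass_m_test_general) auto
    have "(\<lambda>w. \<Sum>k\<in>F. coeff k * num w k) holomorphic_on A" for F A
      unfolding num_def using q_less_1 by (intro holomorphic_intros)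
    then show "\<forall>\<^sub>F F in finite_subsets_at_top (multi_indices n).
        continuous_on (cball 0 \<rho>) (\<lambda>w. \<Sum>k\<in>F. coeff k * num w k) \<and> (\<lambda>w. \<Sum>k\<in>F. coeff k * num w k) holomorphic_on ball 0 \<rho>"
      by (intro always_eventually allI conjI holomorphic_on_imp_continuous_on)
  qed auto
  have Zw: "norm (Z * w) < 1" if "norm w \<le> \<rho>" for w
    using mult_left_mono[OF that norm_ge_zero[of Z]] \<rho>(2) by (simp add: norm_mult)
  \<comment> \<open>The only denominator of \<open>h\<close> still involving \<open>w\<close> is
    \<open>qpoch_inf q (Z * w)\<close>, which cannot vanish because \<open>Z * w\<close> has norm
    below 1.\<close>
  have h_holo: "h holomorphic_on ball 0 \<rho>"
  proof -
    have "qpoch_inf q (Z * w) \<noteq> 0" if "w \<in> ball 0 \<rho>" for w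
      using that by (intro qpoch_inf_nonzero q_less_1 Zw) simp
    then show ?thesis
      unfolding h_def using q_less_1 c_nz b_nz[OF p] q_nonzero by (intro holomorphic_intros) simp_all
  qed
  \<comment> \<open>At such \<open>w\<close> the index \<open>p\<close> is again special, so the
    induction hypothesis for \<open>J\<close> applies. The first bound gives its convergence
    condition, the second the nonvanishing of \<open>qpoch_inf q (\<alpha> * w)\<close>.\<close>
  have eq_on_nodes: "f w = h w" if w: "w = x p * q ^ Suc m" "norm w < \<rho>" "norm (\<alpha> * w) < 1" for w m
  proof -
    have w_nz: "qpoch_inf q (\<alpha> * w) \<noteq> 0" using w q_less_1 by (intro qpoch_inf_nonzero)
    have "(summand \<alpha> b c (y(p := w)) has_sum closed_form \<alpha> b c (y(p := w))) (multi_indices n)"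
    proof (rule insert.IH)
      show "norm (\<alpha> * b * c * (\<Prod>r=1..n. (y(p := w)) r) / (q ^ (1 + n) * (\<Prod>r=1..n. x r))) < 1"
        using z[of w] Zw[of w] w by (simp add: X_def)
      show "\<exists>m. (y(p := w)) s = x s * q ^ Suc m" if "s \<in> {1..n} - J" for s
        using insert.prems(2)[of s] that w by auto
    qed (use insert.prems w w_nz x_nonzero[OF p] q_nonzero in auto)
    then have "((\<lambda>k. summand \<alpha> b c (y(p := w)) k * qpoch_inf q (\<alpha> * w)) has_sum closed_form \<alpha> b c (y(p := w)) * qpoch_inf q (\<alpha> * w)) (multi_indices n)"
      by (rule has_sum_cmult_left)
    then show ?thesis
      unfolding summand_eq[OF w_nz] closed_form_eq[OF w_nz]
      using f_has_sum[of w] w by (intro has_sum_unique) auto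
  qed
  have lim: "(\<lambda>m. x p * q ^ Suc m) \<longlonglongrightarrow> 0"
    using tendsto_mult[OF tendsto_const[of "x p"] LIMSEQ_Suc[OF LIMSEQ_power_zero[OF q_less_1]]] by simp
  have "\<forall>\<^sub>F m in sequentially. norm (x p * q ^ Suc m) < \<rho> \<and> norm (\<alpha> * (x p * q ^ Suc m)) < 1"
  proof (intro eventually_conj)
    show "\<forall>\<^sub>F m in sequentially. norm (x p * q ^ Suc m) < \<rho>"
      using tendsto_norm[OF lim] \<rho>0 by (intro order_tendstoD) auto
    show "\<forall>\<^sub>F m in sequentially. norm (\<alpha> * (x p * q ^ Suc m)) < 1"
      using tendsto_norm[OF tendsto_mult[OF tendsto_const[of \<alpha>] lim]] by (intro order_tendstoD) auto
  qed
  then obtain N where N: "\<And>m. m \<ge> N \<Longrightarrow> norm (x p * q ^ Suc m) < \<rho> \<and> norm (\<alpha> * (x p * q ^ Suc m)) < 1"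
    by (auto simp: eventually_sequentially)
  \<comment> \<open>Beyond \<open>N\<close> both bounds hold, and these points still accumulate at
    0, an interior point of the disc.\<close>
  define U where "U = (\<lambda>m. x p * q ^ Suc (m + N)) ` UNIV"
  have "0 islimpt U"
    unfolding islimpt_sequential
  proof (intro exI conjI allI)
    show "(\<lambda>m. x p * q ^ Suc (m + N)) \<longlonglongrightarrow> 0"
      using LIMSEQ_ignore_initial_segment[OF lim, of N] by simp
  qed (use x_nonzero[OF p] q_nonzero in \<open>auto simp: U_def\<close>)
  moreover have "(\<lambda>w. f w - h w) holomorphic_on ball 0 \<rho>"
    by (intro holomorphic_intros f_holo h_holo)
  moreover have "f w - h w = 0" if "w \<in> U" for w
    using that N eq_on_nodes by (auto simp: U_def simp del: power_Suc)
  moreover have "U \<subseteq> ball 0 \<rho>"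
    using N by (auto simp: U_def simp del: power_Suc)
  ultimately have "f (y p) - h (y p) = 0"
    using \<rho> \<rho>0 analytic_continuation[of "\<lambda>w. f w - h w" "ball 0 \<rho>" U 0 "y p"] by simp
  then have "((\<lambda>k. coeff k * num (y p) k) has_sum h (y p)) (multi_indices n)"
    using f_has_sum[of "y p"] \<rho> by simp
  then have "((\<lambda>k. summand \<alpha> b c y k * qpoch_inf q (\<alpha> * y p)) has_sum closed_form \<alpha> b c y * qpoch_inf q (\<alpha> * y p)) (multi_indices n)"
    using summand_eq[of "y p"] closed_form_eq[of "y p"] insert.prems(4)[OF p] by simp
  then show ?case
    using insert.prems(4)[OF p] by (simp add: has_sum_cmult_left_iff)
qed

end

section \<open>The summation theorem\<close>

text \<open>Multiplying the factor of each pair \<open>r < s\<close> by \<open>q ^ k s\<close>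
  removes the negative exponents; the index \<open>s\<close> is the larger one in
  \<open>s - 1\<close> pairs, which accounts for the total power of \<open>q\<close>.\<close>

lemma vand_eq:
  assumes "q \<noteq> 0" and "\<And>r. r \<in> {1..n} \<Longrightarrow> x r \<noteq> 0"
  shows "(\<Prod>r=1..n. \<Prod>s\<in>{r<..n}. (1 - q powi (int (k r) - int (k s)) * x r / x s) / (1 - x r / x s))
    * q ^ (\<Sum>r=1..n. (r - 1) * k r) = vand q x n k"
proof -
  have "(\<Sum>r=1..n. (r - 1) * k r) = (\<Sum>s=1..n. \<Sum>r\<in>{r \<in> {1..n}. r < s}. k s)"
  proof (intro sum.cong refl)
    fix s assume "s \<in> {1..n}"
    then have "{r \<in> {1..n}. r < s} = {1..<s}" by auto
    then show "(s - 1) * k s = (\<Sum>r\<in>{r \<in> {1..n}. r < s}. k s)" by simp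
  qed
  also have "\<dots> = (\<Sum>r=1..n. \<Sum>s\<in>{s \<in> {1..n}. r < s}. k s)"
    by (rule sum.swap_restrict) auto
  also have "\<dots> = (\<Sum>r=1..n. \<Sum>s\<in>{r<..n}. k s)"
    by (intro sum.cong refl) auto
  finally have "q ^ (\<Sum>r=1..n. (r - 1) * k r) = (\<Prod>r=1..n. \<Prod>s\<in>{r<..n}. q ^ k s)"
    by (simp add: power_sum)
  moreover have "(1 - q powi (int (k r) - int (k s)) * x r / x s) / (1 - x r / x s) * q ^ k s
      = (x s * q ^ k s - x r * q ^ k r) / (x s - x r)" if "r \<in> {1..n}" "s \<in> {r<..n}" for r s
  proof -
    have "q powi (int (k r) - int (k s)) * q ^ k s = q ^ k r"
      using assms(1) by (simp add: power_int_diff)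
    then have "(1 - q powi (int (k r) - int (k s)) * x r / x s) * q ^ k s = q ^ k s - q ^ k r * x r / x s"
      by (simp add: algebra_simps)
    moreover have "x s \<noteq> 0" using assms(2) that by auto
    ultimately show ?thesis by (simp add: divide_simps)
  qed
  ultimately show ?thesis
    by (auto simp: vand_def prod.distrib [symmetric] intro!: prod.cong)
qed

context generic_nodes
begin

text \<open>Passing from \<open>qpoch\<close> to \<open>qfall\<close> costs powers of
  \<open>b\<close>, \<open>c\<close> and the y_s, and these are exactly the ones contained in the
  argument of the series.\<close>

lemma summand_expand:
  assumes "b \<noteq> 0" "c \<noteq> 0" and a: "\<And>r. r \<in> {1..n} \<Longrightarrow> a r \<noteq> 0"
  shows "(\<Prod>r=1..n. \<Prod>s\<in>{r<..n}.
              (1 - q powi (int (k r) - int (k s)) * x r / x s) / (1 - x r / x s))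
         * (\<Prod>r=1..n. \<Prod>s=1..n.
              qpoch q (q * x r / (x s * a s)) (k r) / qpoch q (q * x r / x s) (k r))
         * (\<Prod>r=1..n. (1 - \<alpha> * x r * q ^ (k r + mi_size n k)) / (1 - \<alpha> * x r))
         * (\<Prod>r=1..n. qpoch q (\<alpha> * x r) (mi_size n k) / qpoch q (\<alpha> * x r * a r) (mi_size n k))
         * q ^ (\<Sum>r=1..n. (r - 1) * k r)
         * (qpoch q (q / b) (mi_size n k) / qpoch q (\<alpha> * c) (mi_size n k))
         * (\<Prod>r=1..n. qpoch q (q * x r / c) (k r) / qpoch q (\<alpha> * b * x r) (k r))
         * (\<alpha> * (\<Prod>r=1..n. a r) * b * c / q ^ (1 + n)) ^ mi_size n k
       = summand \<alpha> b c (\<lambda>r. x r * a r) k"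
    (is "?A1 * ?A2 * ?A3 * ?A4 * ?A5 * (?B / ?Cc) * ?A7 * ?A8 = _")
proof -
  define K where "K = mi_size n k"
  define y where "y = (\<lambda>r. x r * a r)"
  define X where "X = (\<Prod>r=1..n. x r)"
  define Y where "Y = (\<Prod>r=1..n. y r)"
  define F where "F = (\<Prod>s=1..n. \<Prod>r=1..n. qfall q (y s) (x r) (k r))"
  define E where "E = (\<Prod>r=1..n. \<Prod>s=1..n. qpoch q (q * x r / x s) (k r))"
  define W where "W = (\<Prod>r=1..n. qpoch q (\<alpha> * b * x r) (k r))"
  define Q where "Q = (\<Prod>r=1..n. qpoch q (\<alpha> * y r) K)"
  define P where "P = (\<Prod>r=1..n. qpoch q (\<alpha> * x r) K)"
  define R where "R = (\<Prod>r=1..n. qfall q c (x r) (k r))"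
  have y0: "y r \<noteq> 0" if "r \<in> {1..n}" for r using that a x_nonzero by (simp add: y_def)
  have nz: "X \<noteq> 0" "Y \<noteq> 0" using y0 x_nonzero by (simp_all add: X_def Y_def)
  have K: "(\<Prod>r=1..n. z ^ k r) = z ^ K" for z :: complex
    by (simp add: K_def mi_size_def power_sum)
  have A15: "?A1 * ?A5 = vand q x n k"
    using q_nonzero x_nonzero by (rule vand_eq)
  have A2: "?A2 = F / Y ^ K / E"
  proof -
    have "(\<Prod>r=1..n. \<Prod>s=1..n. qpoch q (q * x r / (x s * a s)) (k r)) = (\<Prod>s=1..n. \<Prod>r=1..n. qpoch q (q * x r / y s) (k r))"
      unfolding y_def by (rule prod.swap)
    also have "\<dots> = (\<Prod>s=1..n. \<Prod>r=1..n. qfall q (y s) (x r) (k r) / y s ^ k r)"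
      using y0 by (intro prod.cong refl) (simp add: qfall_eq_qpoch)
    also have "\<dots> = F / Y ^ K"
      by (simp only: prod_dividef F_def Y_def K prod_power_distrib)
    finally show ?thesis by (simp add: prod_dividef E_def)
  qed
  have A4: "?A4 = P / Q"
    by (simp add: prod_dividef P_def Q_def K_def y_def mult.assoc)
  have A7: "?A7 = R / c ^ K / W"
  proof -
    have "(\<Prod>r=1..n. qpoch q (q * x r / c) (k r)) = (\<Prod>r=1..n. qfall q c (x r) (k r) / c ^ k r)"
      using assms(2) by (intro prod.cong refl) (simp add: qfall_eq_qpoch)
    then show ?thesis by (simp only: prod_dividef R_def W_def K)
  qed
  have B: "?B = qfall q b 1 K / b ^ K"
    using assms(1) by (simp add: qfall_eq_qpoch K_def)
  have "\<alpha> * (\<Prod>r=1..n. a r) * b * c / q ^ (1 + n) = \<alpha> / (q ^ (1 + n) * X) * Y * b * c"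
    using nz by (simp add: Y_def y_def X_def prod.distrib)
  then have A8: "?A8 = (\<alpha> / (q ^ (1 + n) * X)) ^ K * Y ^ K * b ^ K * c ^ K"
    by (simp only: power_mult_distrib K_def)
  have nodes: "(\<Prod>s=1..n. node q \<alpha> x n (y s) k) = F / Q"
    by (simp only: node_def prod_dividef F_def Q_def K_def)
  have "?A1 * ?A2 * ?A3 * ?A4 * ?A5 * (?B / ?Cc) * ?A7 * ?A8
      = (?A1 * ?A5) * ?A2 * ?A3 * ?A4 * (?B / ?Cc) * ?A7 * ?A8"
    by (simp only: mult_ac)
  also have "\<dots> = vand q x n k / E * (?A3 * P) * qfall q b 1 K / W * (\<alpha> / (q ^ (1 + n) * X)) ^ K * (R / ?Cc * (F / Q))"
    unfolding A15 A2 A4 A7 B A8 using nz assms(1,2) by (simp add: divide_simps)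
  also have "?A3 * P = (\<Prod>r=1..n. (1 - \<alpha> * x r * q ^ (k r + K)) * qpoch q (\<alpha> * x r) K / (1 - \<alpha> * x r))"
    unfolding P_def K_def prod.distrib [symmetric] by (intro prod.cong) auto
  finally show ?thesis
    unfolding summand_def y_def [symmetric] nodes
    unfolding weight_def node_def E_def W_def X_def R_def K_def by simp
qed

end

theorem theorem4p1:
  fixes q \<alpha> b c :: complex and a x :: "nat \<Rightarrow> complex" and n :: nat
  assumes q: "0 < norm q" "norm q < 1"
    and n: "1 \<le> n"
    and conv_or_term:
      "norm (\<alpha> * (\<Prod>r=1..n. a r) * b * c / q ^ (1 + n)) < 1 \<or>
       (\<forall>r\<in>{1..n}. \<exists>N::nat. 0 < N \<and> a r = q ^ N)"
    and lhs_denoms: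
      "qpoch_inf q (\<alpha> * c) \<noteq> 0"
      "qpoch_inf q (\<alpha> * (\<Prod>r=1..n. a r) * b * c * q powi (- (1 + int n))) \<noteq> 0"
      "\<forall>r\<in>{1..n}. qpoch_inf q (\<alpha> * b * x r) \<noteq> 0"
      "\<forall>r\<in>{1..n}. qpoch_inf q (\<alpha> * a r * x r) \<noteq> 0"
    and rhs_denoms:
      "b \<noteq> 0" "c \<noteq> 0"
      "\<forall>r\<in>{1..n}. x r \<noteq> 0"
      "\<forall>r\<in>{1..n}. a r \<noteq> 0"
      "\<forall>r\<in>{1..n}. \<forall>s\<in>{1..n}. r < s \<longrightarrow> 1 - x r / x s \<noteq> 0"
      "\<forall>r\<in>{1..n}. \<forall>s\<in>{1..n}. \<forall>m. qpoch q (q * x r / x s) m \<noteq> 0"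
      "\<forall>r\<in>{1..n}. 1 - \<alpha> * x r \<noteq> 0"
      "\<forall>r\<in>{1..n}. \<forall>m. qpoch q (\<alpha> * x r * a r) m \<noteq> 0"
      "\<forall>m. qpoch q (\<alpha> * c) m \<noteq> 0"
      "\<forall>r\<in>{1..n}. \<forall>m. qpoch q (\<alpha> * b * x r) m \<noteq> 0"
  shows
    "((\<lambda>k. (\<Prod>r=1..n. \<Prod>s\<in>{r<..n}.
              (1 - q powi (int (k r) - int (k s)) * x r / x s) / (1 - x r / x s))
         * (\<Prod>r=1..n. \<Prod>s=1..n.
              qpoch q (q * x r / (x s * a s)) (k r) / qpoch q (q * x r / x s) (k r))
         * (\<Prod>r=1..n. (1 - \<alpha> * x r * q ^ (k r + mi_size n k)) / (1 - \<alpha> * x r))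
         * (\<Prod>r=1..n. qpoch q (\<alpha> * x r) (mi_size n k) / qpoch q (\<alpha> * x r * a r) (mi_size n k))
         * q ^ (\<Sum>r=1..n. (r - 1) * k r)
         * (qpoch q (q / b) (mi_size n k) / qpoch q (\<alpha> * c) (mi_size n k))
         * (\<Prod>r=1..n. qpoch q (q * x r / c) (k r) / qpoch q (\<alpha> * b * x r) (k r))
         * (\<alpha> * (\<Prod>r=1..n. a r) * b * c / q ^ (1 + n)) ^ mi_size n k)
      has_sum
        ((qpoch_inf q (\<alpha> * b * c / q)
            * qpoch_inf q (\<alpha> * (\<Prod>r=1..n. a r) * c * q powi (- int n)))
         / (qpoch_inf q (\<alpha> * c)
            * qpoch_inf q (\<alpha> * (\<Prod>r=1..n. a r) * b * c * q powi (- (1 + int n))))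
         * (\<Prod>r=1..n.
              (qpoch_inf q (\<alpha> * q * x r) * qpoch_inf q (\<alpha> * a r * b * x r / q))
              / (qpoch_inf q (\<alpha> * b * x r) * qpoch_inf q (\<alpha> * a r * x r)))))
     (multi_indices n)"
    (is "(?lhs has_sum _) _")
proof -
  interpret generic_nodes q x n
  proof
    fix r s i assume r: "r \<in> {1..n}" and s: "s \<in> {1..n}" and ne: "r \<noteq> s"
    have nz: "x r \<noteq> 0" "x s \<noteq> 0" using rhs_denoms(3) r s by auto
    \<comment> \<open>Equal nodes are excluded by the denominators \<open>1 - x r / x s\<close>,
      whose indices must first be ordered; positive powers of \<open>q\<close> are excluded by the
      last factor of \<open>qpoch q (q * x s / x r) i\<close>.\<close>
    show "x r \<noteq> x s * q ^ i"
    proof (cases i)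
      case 0
      have "x r \<noteq> x s"
        using rhs_denoms(5) r s ne nz by (cases r s rule: linorder_cases) fastforce+
      then show ?thesis using 0 by simp
    next
      case (Suc j)
      have "qpoch q (q * x s / x r) (Suc j) \<noteq> 0" using rhs_denoms(6) r s by blast
      then show ?thesis using nz Suc by (auto simp: qpoch_Suc field_simps)
    qed
  qed (use q rhs_denoms in auto)
  define y where "y = (\<lambda>r. x r * a r)"
  define X where "X = (\<Prod>r=1..n. x r)"
  have X0: "X \<noteq> 0" using x_nonzero by (simp add: X_def)
  have Y: "(\<Prod>r=1..n. y r) = X * (\<Prod>r=1..n. a r)" by (simp add: y_def X_def prod.distrib)
  have args: "\<alpha> * b * c * (\<Prod>r=1..n. y r) / (q ^ (1 + n) * X) = \<alpha> * (\<Prod>r=1..n. a r) * b * c / q ^ (1 + n)"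
    "\<alpha> * c * (\<Prod>r=1..n. y r) / (q ^ n * X) = \<alpha> * (\<Prod>r=1..n. a r) * c / q ^ n"
    unfolding Y using X0 by (simp_all add: mult_ac)
  have "1 + int n = int (1 + n)" by simp
  then have powi: "z * q powi (- (1 + int n)) = z / q ^ (1 + n)" "z * q powi (- int n) = z / q ^ n" for z
    by (simp_all only: power_int_minus power_int_of_nat divide_inverse)
  have hyps: "\<And>r. r \<in> {1..n} \<Longrightarrow> 1 - \<alpha> * x r \<noteq> 0"
    "\<And>r. r \<in> {1..n} \<Longrightarrow> qpoch_inf q (\<alpha> * b * x r) \<noteq> 0"
    "\<And>r. r \<in> {1..n} \<Longrightarrow> qpoch_inf q (\<alpha> * y r) \<noteq> 0"
    using lhs_denoms(3,4) rhs_denoms(7) by (auto simp: y_def mult_ac)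
  have z_nz: "qpoch_inf q (\<alpha> * b * c * (\<Prod>r=1..n. y r) / (q ^ (1 + n) * (\<Prod>r=1..n. x r))) \<noteq> 0"
    using lhs_denoms(2) unfolding powi args [symmetric] X_def .
  from conv_or_term have main: "(summand \<alpha> b c y has_sum closed_form \<alpha> b c y) (multi_indices n)"
  proof
    assume "norm (\<alpha> * (\<Prod>r=1..n. a r) * b * c / q ^ (1 + n)) < 1"
    then show ?thesis
      using rhs_denoms(1,2,4) hyps lhs_denoms(1) x_nonzero unfolding args [symmetric] X_def
      \<comment> \<open>With \<open>J\<close> the full index set, no \<open>y s\<close> is required
        to be special.\<close>
      by (intro nonterminating_has_sum[where J = "{1..n}"]) (auto simp: y_def)
  next
    assume "\<forall>r\<in>{1..n}. \<exists>N::nat. 0 < N \<and> a r = q ^ N"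
    \<comment> \<open>The exponent is positive, so it is a successor, as the special values
      \<open>x s * q ^ Suc (m s)\<close> require.\<close>
    then have "\<forall>r\<in>{1..n}. \<exists>m. a r = q ^ Suc m" using gr0_implies_Suc by blast
    then obtain m where "\<And>r. r \<in> {1..n} \<Longrightarrow> a r = q ^ Suc (m r)" by metis
    then show ?thesis
      using hyps lhs_denoms(1) z_nz by (intro terminating_has_sum[where m = m]) (auto simp: y_def)
  qed
  have closed_form: "closed_form \<alpha> b c y = (qpoch_inf q (\<alpha> * b * c / q)
            * qpoch_inf q (\<alpha> * (\<Prod>r=1..n. a r) * c * q powi (- int n)))
         / (qpoch_inf q (\<alpha> * c)
            * qpoch_inf q (\<alpha> * (\<Prod>r=1..n. a r) * b * c * q powi (- (1 + int n))))
         * (\<Prod>r=1..n.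
              (qpoch_inf q (\<alpha> * q * x r) * qpoch_inf q (\<alpha> * a r * b * x r / q))
              / (qpoch_inf q (\<alpha> * b * x r) * qpoch_inf q (\<alpha> * a r * x r)))"
    unfolding closed_form_def powi X_def [symmetric] args by (simp add: y_def mult_ac)
  show ?thesis
    unfolding closed_form [symmetric]
  proof (rule iffD2[OF has_sum_cong main])
    fix k
    show "?lhs k = summand \<alpha> b c y k"
      unfolding y_def using rhs_denoms(1,2,4) by (intro summand_expand) blast+
  qed
qed

end
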